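(* $\mathcal{G}^+=\mathcal{H}_-\cup\mathcal{H}_+\cup\mathcal{H}_\infty$.
   Context: $C(\mathbb{R}^2)$ is the space of continuous real-valued functions on $\mathbb{R}^2$. For $F\in C(\mathbb{R}^2)$ and $(x,y)\in\mathbb{R}^2$, $\mathcal{S}^+_{F,(x,y)}$ is the set of $\varphi\in C^1([x,b))$ for some $x<b\le+\infty$ with $\varphi(x)=y$, $\varphi'(t)=F(t,\varphi(t))$ for all $t\in[x,b)$ (right derivative at $x$), non-extendible to the right (i.e. restrictions to $[x,+\infty)$ of maximal solutions of the Cauchy problem $\varphi'=F(t,\varphi)$, $\varphi(x)=y$). For $\varphi$ with $b=\sup\mathrm{dom}(\varphi)$, $\lim_+\varphi=\lim_{t\to b^-}\varphi(t)$. $\mathcal{G}^+$ is the set of $(F,x,y)\in C(\mathbb{R}^2)\times\mathbb{R}^2$ such that some $\varphi\in\mathcal{S}^+_{F,(x,y)}$ has domain $[x,+\infty)$. $\mathcal{H}_-$ is the set of $(F,x,y)$ for which there exist $N,h\in\mathbb{N}$ such that (i) for every $n\ge1$ there is $\varphi_n\in\mathcal{S}^+_{F,(x,y)}$ with $[x,x+N+n]\subset\mathrm{dom}(\varphi_n)$ and $\|\varphi_n\restriction[x,x+N]\|_\infty\le h$, and (ii) there is no $\varphi\in\mathcal{S}^+_{F,(x,y)}$ with $[x,x+N]\subset\mathrm{dom}(\varphi)$, $\|\varphi\restriction[x,x+N]\|_\infty\le h$ and $\lim_+\varphi=-\infty$. $\mathcal{H}_+$ is defined the same way with $+\infty$ in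 place of $-\infty$ in (ii). $\mathcal{H}_\infty$ is the set of $(F,x,y)$ such that for every $n\ge1$ there exist $\varphi_n,\psi_n\in\mathcal{S}^+_{F,(x,y)}$ with $[x,x+n]\subset\mathrm{dom}(\varphi_n)\cap\mathrm{dom}(\psi_n)$, $\lim_+\varphi_n=+\infty$ and $\lim_+\psi_n=-\infty$. *)

theory Defs
  imports "HOL-Analysis.Analysis"
begin

text \<open>
  A real function on a subset of the line is a partial function \<open>real \<rightharpoonup> real\<close>,
  so that \<open>dom\<close> is its domain and extension is \<open>\<subseteq>\<^sub>m\<close>.
\<close>

abbreviation app :: "(real \<rightharpoonup> real) \<Rightarrow> real \<Rightarrow> real" where
  "app \<phi> t \<equiv> the (\<phi> t)"

definition C_plane :: "(real \<times> real \<Rightarrow> real) set" where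
  "C_plane = {F. continuous_on UNIV F}"

definition C1_on :: "real set \<Rightarrow> (real \<Rightarrow> real) \<Rightarrow> bool" where
  "C1_on S f \<longleftrightarrow>
     (\<exists>f'. (\<forall>t\<in>S. (f has_real_derivative f' t) (at t within S)) \<and> continuous_on S f')"

text \<open>At \<open>t = x\<close> the derivative within \<open>[x,b)\<close> is the right derivative.\<close>

definition right_solution ::
  "(real \<times> real \<Rightarrow> real) \<Rightarrow> real \<Rightarrow> real \<Rightarrow> (real \<rightharpoonup> real) \<Rightarrow> bool" where
  "right_solution F x y \<phi> \<longleftrightarrow>
     (\<exists>b::ereal. ereal x < b \<and> dom \<phi> = {t. x \<le> t \<and> ereal t < b}) \<and>
     C1_on (dom \<phi>) (app \<phi>) \<and>
     \<phi> x = Some y \<and>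
     (\<forall>t\<in>dom \<phi>. (app \<phi> has_real_derivative F (t, app \<phi> t)) (at t within dom \<phi>))"

definition S_plus ::
  "(real \<times> real \<Rightarrow> real) \<Rightarrow> real \<Rightarrow> real \<Rightarrow> (real \<rightharpoonup> real) set" where
  "S_plus F x y =
     {\<phi>. right_solution F x y \<phi> \<and>
         (\<forall>\<psi>. right_solution F x y \<psi> \<and> \<phi> \<subseteq>\<^sub>m \<psi> \<longrightarrow> \<psi> = \<phi>)}"

text \<open>
  \<open>has_lim_plus \<phi> l\<close> means that the limit of \<open>\<phi>\<close> at the right end
  \<open>b = sup (dom \<phi>) \<le> \<infinity>\<close> exists in the extended reals and equals \<open>l\<close>.
  The filter is taken on the extended reals so that finite and infinite \<open>b\<close>
  are treated uniformly.
\<close>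

definition has_lim_plus :: "(real \<rightharpoonup> real) \<Rightarrow> ereal \<Rightarrow> bool" where
  "has_lim_plus \<phi> l \<longleftrightarrow>
     ((\<lambda>s::ereal. ereal (app \<phi> (real_of_ereal s))) \<longlongrightarrow> l)
       (at_left (Sup (ereal ` dom \<phi>)))"

definition sup_norm_on :: "real set \<Rightarrow> (real \<rightharpoonup> real) \<Rightarrow> real" where
  "sup_norm_on S \<phi> = (SUP t\<in>S. \<bar>app \<phi> t\<bar>)"

definition G_plus :: "((real \<times> real \<Rightarrow> real) \<times> real \<times> real) set" where
  "G_plus = {(F, x, y). F \<in> C_plane \<and> (\<exists>\<phi>\<in>S_plus F x y. dom \<phi> = {x..})}"

text \<open>The sets \<open>H_minus\<close> and \<open>H_plus\<close> differ only in the excluded limit \<open>l\<close>.\<close>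

definition H_excl :: "ereal \<Rightarrow> ((real \<times> real \<Rightarrow> real) \<times> real \<times> real) set" where
  "H_excl l = {(F, x, y). F \<in> C_plane \<and>
     (\<exists>N h::nat.
        (\<forall>n::nat\<ge>1. \<exists>\<phi>\<in>S_plus F x y.
            {x .. x + real N + real n} \<subseteq> dom \<phi> \<and>
            sup_norm_on {x .. x + real N} \<phi> \<le> real h) \<and>
        \<not> (\<exists>\<phi>\<in>S_plus F x y.
            {x .. x + real N} \<subseteq> dom \<phi> \<and>
            sup_norm_on {x .. x + real N} \<phi> \<le> real h \<and>
            has_lim_plus \<phi> l))}"

definition H_minus :: "((real \<times> real \<Rightarrow> real) \<times> real \<times> real) set" where
  "H_minus = H_excl (-\<infinity>)"

definition H_plus :: "((real \<times> real \<Rightarrow> real) \<times> real \<times> real) set" where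
  "H_plus = H_excl \<infinity>"

definition H_infty :: "((real \<times> real \<Rightarrow> real) \<times> real \<times> real) set" where
  "H_infty = {(F, x, y). F \<in> C_plane \<and>
     (\<forall>n::nat\<ge>1. \<exists>\<phi>\<in>S_plus F x y. \<exists>\<psi>\<in>S_plus F x y.
        {x .. x + real n} \<subseteq> dom \<phi> \<inter> dom \<psi> \<and>
        has_lim_plus \<phi> \<infinity> \<and> has_lim_plus \<psi> (-\<infinity>))}"

end

theory Submission
  imports Defs "HOL-Complex_Analysis.Great_Picard"
begin

text \<open>
  A solution that blows up is continued by the constant value \<open>\<plusminus>\<infinity>\<close> it blows up to. The resulting
  continuous functions into the extended reals are closed under \<open>min\<close>, \<open>max\<close> and pointwise limits.
  In the first two cases, if there is no global solution, the given solutions all blow up in the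
  non-excluded direction; their infimum (or supremum) is then a solution that can only be infinite in
  the excluded direction, and condition (ii) forbids that. In the third case
  the solutions blowing up to \<open>+\<infinity>\<close> and to \<open>-\<infinity>\<close> are clamped between each other, which gives a
  decreasing and an increasing sequence, the first above the second, with life spans tending to
  infinity; the limit of the upper sequence is finite everywhere.
\<close>

section \<open>Extended solutions\<close>

text \<open>The approximating solutions have no common bound: each may explode just after its
  guaranteed life span, so compactness arguments do not apply to them directly. Truncation to [-R,R]
  removes the obstacle: inside such a band the slope of any solution is bounded by the maximum of
  |F| there, so truncated solutions share a Lipschitz constant on compact time intervals, and a
  pointwise limit is again a solution wherever it is finite. The lattice operations work in spite of
  non-uniqueness because two solutions that meet at a finite value have the same slope there. The
  bound h on [x,x+N] in (i) passes to the infimum or supremum, so its blow-up comes after x+N and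
  (ii) applies to it. The inclusion of G+ in the union is elementary: a global solution serves as
  every phi_n, with h at least its norm on [x,x+N]. Outside H_- and H_+, condition (ii) therefore
  fails for every N, in both directions, and this is H_infty.\<close>

definition clip :: "real \<Rightarrow> ereal \<Rightarrow> real" where
  "clip R z = real_of_ereal (max (- ereal R) (min (ereal R) z))"

lemma clip_ereal: "clip R (ereal a) = max (-R) (min R a)"
  unfolding clip_def by (metis ereal_max ereal_min real_of_ereal.simps(1) uminus_ereal.simps(1))

lemma clip_infinity: "0 \<le> R \<Longrightarrow> clip R \<infinity> = R" "0 \<le> R \<Longrightarrow> clip R (-\<infinity>) = -R"
  unfolding clip_def by (auto simp: max_def min_def)

lemma abs_clip_le: "0 \<le> R \<Longrightarrow> \<bar>clip R z\<bar> \<le> R"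
  by (cases z) (auto simp: clip_ereal clip_infinity)

lemma less_clip_iff: "\<bar>r\<bar> < R \<Longrightarrow> r < clip R z \<longleftrightarrow> ereal r < z"
  by (cases z) (auto simp: clip_ereal clip_infinity)

lemma clip_less_iff: "\<bar>r\<bar> < R \<Longrightarrow> clip R z < r \<longleftrightarrow> z < ereal r"
  by (cases z) (auto simp: clip_ereal clip_infinity)

lemma clip_inner: "\<bar>clip R z\<bar> < R \<Longrightarrow> z = ereal (clip R z)"
  using abs_ge_zero[of "clip R z"] by (cases z) (auto simp: clip_ereal clip_infinity max_def min_def split: if_splits)

lemma tendsto_clip:
  assumes "(f \<longlongrightarrow> z) G" shows "((\<lambda>t. clip R (f t)) \<longlongrightarrow> clip R z) G"
proof -
  have "((\<lambda>t. max (- ereal R) (min (ereal R) (f t))) \<longlongrightarrow> max (- ereal R) (min (ereal R) z)) G"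
    by (intro tendsto_intros assms)
  moreover have "max (- ereal R) (min (ereal R) z) = ereal (clip R z)"
    unfolding clip_def by (cases z) (auto simp: max_def min_def)
  ultimately show ?thesis
    unfolding clip_def by (simp add: lim_real_of_ereal)
qed

text \<open>Neighbourhoods in the extended reals are tested by open rays. A real \<open>r\<close>
  separates the end of the ray from the limit, and truncation at any level above |r| preserves
  comparison with \<open>r\<close>. Convergence thus reduces to bounded real functions.\<close>

lemma tendsto_if_tendsto_clip:
  assumes "\<And>R. 0 < R \<Longrightarrow> ((\<lambda>t. clip R (f t)) \<longlongrightarrow> clip R z) G"
  shows "(f \<longlongrightarrow> z) G"
proof (rule order_tendstoI)
  fix a assume "a < z"
  then obtain r where r: "a < ereal r" "ereal r < z" using ereal_dense2 by blast
  have R: "\<bar>r\<bar> < \<bar>r\<bar> + 1" by simp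
  have "\<forall>\<^sub>F t in G. r < clip (\<bar>r\<bar>+1) (f t)"
    using r(2) less_clip_iff[OF R, of z] by (intro order_tendstoD(1)[OF assms]) auto
  then show "\<forall>\<^sub>F t in G. a < f t"
    unfolding less_clip_iff[OF R] by eventually_elim (use r in order)
next
  fix a assume "z < a"
  then obtain r where r: "ereal r < a" "z < ereal r" using ereal_dense2 by blast
  have R: "\<bar>r\<bar> < \<bar>r\<bar> + 1" by simp
  have "\<forall>\<^sub>F t in G. clip (\<bar>r\<bar>+1) (f t) < r"
    using r(2) clip_less_iff[OF R, of z] by (intro order_tendstoD(2)[OF assms]) auto
  then show "\<forall>\<^sub>F t in G. f t < a"
    unfolding clip_less_iff[OF R] by eventually_elim (use r in order)
qed

text \<open>The derivative is controlled only where \<open>g\<close> is strictly between its end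
  values, because a truncated solution may have corners at the levels R and -R. With s' the last
  time at or below \<open>g s\<close> and t' the first later time at or above \<open>g t\<close>,
  the mean value theorem on [s',t'] meets only such points.\<close>

lemma increment_le_if_derivative_bounded_inside:
  fixes g :: "real \<Rightarrow> real"
  assumes cont: "continuous_on {s..t} g" and st: "s \<le> t" and M: "0 \<le> M"
    and der: "\<And>r. s < r \<Longrightarrow> r < t \<Longrightarrow> g s < g r \<Longrightarrow> g r < g t \<Longrightarrow>
                 \<exists>D. (g has_real_derivative D) (at r) \<and> D \<le> M"
  shows "g t - g s \<le> M * (t - s)"
proof (cases "g s < g t")
  case False
  then show ?thesis using st M by (smt (verit) mult_nonneg_nonneg)
next
  case True
  let ?A = "{r\<in>{s..t}. g r \<le> g s}"
  have "compact ?A"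
    using continuous_closed_preimage[OF cont, of "{..g s}"]
    by (auto simp: compact_eq_bounded_closed vimage_def Int_def intro: bounded_subset[OF bounded_closed_interval[of s t]])
  moreover have "s \<in> ?A" using st by auto
  ultimately obtain s' where s': "s' \<in> ?A" "\<And>r. r \<in> ?A \<Longrightarrow> r \<le> s'"
    using compact_attains_sup[of ?A] by blast
  let ?B = "{r\<in>{s'..t}. g t \<le> g r}"
  have cont': "continuous_on {s'..t} g" using cont s' by (auto intro: continuous_on_subset)
  have "compact ?B"
    using continuous_closed_preimage[OF cont', of "{g t..}"]
    by (auto simp: compact_eq_bounded_closed vimage_def Int_def intro: bounded_subset[OF bounded_closed_interval[of s' t]])
  moreover have "t \<in> ?B" using s' by auto
  ultimately obtain t' where t': "t' \<in> ?B" "\<And>r. r \<in> ?B \<Longrightarrow> t' \<le> r"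
    using compact_attains_inf[of ?B] by blast
  have lt: "s' < t'" using s' t' True by (smt (verit) atLeastAtMost_iff mem_Collect_eq)
  have der': "\<exists>D. (g has_real_derivative D) (at r) \<and> D \<le> M" if "s' < r" "r < t'" for r
  proof (rule der)
    show "s < r" "r < t" using that s'(1) t'(1) by auto
    then show "g s < g r" "g r < g t" using that s'(2)[of r] t'(2)[of r] s'(1) t'(1) by force+
  qed
  then have "\<And>r. s' < r \<Longrightarrow> r < t' \<Longrightarrow> g differentiable (at r)"
    using real_differentiable_def by blast
  moreover have "continuous_on {s'..t'} g" 
    using s'(1) t'(1) by (intro continuous_on_subset[OF cont]) auto
  ultimately obtain l z where z: "s' < z" "z < t'" "DERIV g z :> l" "g t' - g s' = (t' - s') * l"
    using MVT[OF lt] by blast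
  have "l \<le> M" using der'[OF z(1,2)] DERIV_unique z(3) by blast
  have "g t - g s \<le> (t' - s') * l" using s'(1) t'(1) z(4) by auto
  also have "\<dots> \<le> (t' - s') * M" using \<open>l \<le> M\<close> lt by simp
  also have "\<dots> \<le> (t - s) * M" using s'(1) t'(1) lt M by (intro mult_right_mono) auto
  finally show ?thesis by (simp add: mult.commute)
qed

text \<open>
  The value may be infinite anywhere, and a solution may even return from infinity: this is what
  makes the notion stable under lattice operations and limits without tracking maximal domains.
\<close>

definition esol :: "(real \<times> real \<Rightarrow> real) \<Rightarrow> real set \<Rightarrow> (real \<Rightarrow> ereal) \<Rightarrow> bool" where
  "esol F I U \<longleftrightarrow> continuous_on I U \<and>
     (\<forall>t\<in>I. \<forall>a. U t = ereal a \<longrightarrow>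
        ((\<lambda>s. real_of_ereal (U s)) has_real_derivative F (t, a)) (at t within I))"

section \<open>Regularity of truncated solutions\<close>

lemma continuous_on_clip: "continuous_on I U \<Longrightarrow> continuous_on I (\<lambda>t. clip R (U t))"
  by (simp add: continuous_on_def tendsto_clip)

text \<open>A strict inequality at \<open>t\<close> persists nearby by continuity, so the truncation
  is inactive in a neighbourhood and coincides with the solution itself.\<close>

lemma esol_has_derivative_clip:
  assumes U: "esol F I U" and t: "t \<in> I" and R: "\<bar>clip R (U t)\<bar> < R"
  shows "((\<lambda>s. clip R (U s)) has_real_derivative F (t, clip R (U t))) (at t within I)"
proof -
  have Ut: "U t = ereal (clip R (U t))" using clip_inner[OF R] .
  have der: "((\<lambda>s. real_of_ereal (U s)) has_real_derivative F (t, clip R (U t))) (at t within I)"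
    using U t Ut unfolding esol_def by blast
  have "((\<lambda>s. clip R (U s)) \<longlongrightarrow> clip R (U t)) (at t within I)"
    using U t continuous_on_clip unfolding esol_def continuous_on_def by blast
  then have "\<forall>\<^sub>F s in at t within I. \<bar>clip R (U s)\<bar> < R"
    using R by (intro order_tendstoD(2)[OF tendsto_rabs])
  then have "\<forall>\<^sub>F s in at t within I. real_of_ereal (U s) = clip R (U s)"
    by eventually_elim (metis clip_inner real_of_ereal.simps(1))
  then show ?thesis
    using der Ut by (subst has_field_derivative_cong_eventually[symmetric]) (auto, metis real_of_ereal.simps(1))
qed

text \<open>Truncation makes extended solutions equicontinuous: the estimate involves only \<open>F\<close>.\<close>

lemma esol_clip_lipschitz:
  assumes U: "esol F I U" and I: "is_interval I" and R: "0 \<le> R"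
    and M: "\<And>r v. r \<in> {p..q} \<Longrightarrow> \<bar>v\<bar> \<le> R \<Longrightarrow> \<bar>F (r, v)\<bar> \<le> M"
    and st: "s \<in> I \<inter> {p..q}" "t \<in> I \<inter> {p..q}"
  shows "\<bar>clip R (U t) - clip R (U s)\<bar> \<le> M * \<bar>t - s\<bar>"
proof -
  have M0: "0 \<le> M" using M[of s 0] st R by force
  have *: "\<bar>clip R (U t) - clip R (U s)\<bar> \<le> M * (t - s)"
    if s: "s \<in> I \<inter> {p..q}" and t: "t \<in> I \<inter> {p..q}" and le: "s \<le> t" for s t
  proof -
    let ?g = "\<lambda>r. clip R (U r)"
    have sub: "{s..t} \<subseteq> I" using I s t by (auto simp: is_interval_1)
    have cont: "continuous_on {s..t} ?g"
      using U sub unfolding esol_def by (blast intro: continuous_on_clip continuous_on_subset)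
    have der: "(?g has_real_derivative F (r, ?g r)) (at r) \<and> \<bar>F (r, ?g r)\<bar> \<le> M"
      if r: "s < r" "r < t" "\<bar>?g r\<bar> < R" for r
    proof
      have "(?g has_real_derivative F (r, ?g r)) (at r within I)"
        using r sub by (intro esol_has_derivative_clip[OF U _ r(3)]) auto
      moreover have "r \<in> interior I"
        using r sub interior_mono[OF sub] by (auto simp: interior_atLeastAtMost_real)
      ultimately show "(?g has_real_derivative F (r, ?g r)) (at r)" by (metis at_within_interior)
      show "\<bar>F (r, ?g r)\<bar> \<le> M" using r s t by (intro M) auto
    qed
    have bd: "\<bar>?g r\<bar> \<le> R" for r using abs_clip_le[OF R] .
    have "?g t - ?g s \<le> M * (t - s)"
    proof (rule increment_le_if_derivative_bounded_inside[OF cont le M0])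
      \<comment> \<open>A value strictly between two numbers of [-R,R] has modulus below R, which is
        where \<open>der\<close> applies.\<close>
      fix r assume "s < r" "r < t" "?g s < ?g r" "?g r < ?g t"
      then show "\<exists>D. (?g has_real_derivative D) (at r) \<and> D \<le> M"
        using der[of r] bd[of s] bd[of t] by (smt (verit))
    qed
    moreover have "- ?g t - - ?g s \<le> M * (t - s)"
    proof (rule increment_le_if_derivative_bounded_inside[OF _ le M0])
      show "continuous_on {s..t} (\<lambda>r. - ?g r)" using cont by (rule continuous_on_minus)
      fix r assume "s < r" "r < t" "- ?g s < - ?g r" "- ?g r < - ?g t"
      then have "(?g has_real_derivative F (r, ?g r)) (at r)" "\<bar>F (r, ?g r)\<bar> \<le> M"
        using der[of r] bd[of s] bd[of t] by (smt (verit))+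
      then show "\<exists>D. ((\<lambda>r. - ?g r) has_real_derivative D) (at r) \<and> D \<le> M"
        by (intro exI[of _ "- F (r, ?g r)"]) (auto intro: DERIV_minus)
    qed
    ultimately show ?thesis by linarith
  qed
  show ?thesis
    using *[of s t] *[of t s] st by (cases "s \<le> t") (auto simp: abs_minus_commute)
qed

text \<open>However wildly \<open>w\<close> switches between \<open>u\<close> and \<open>v\<close>,
  each of its difference quotients at \<open>t\<close> is one of theirs, and both families tend to
  \<open>D\<close>.\<close>

lemma has_derivative_select:
  fixes u v w :: "real \<Rightarrow> real"
  assumes "(u has_real_derivative D) (at t within I)" "(v has_real_derivative D) (at t within I)"
    and "u t = w t" "v t = w t" "\<forall>\<^sub>F s in at t within I. w s = u s \<or> w s = v s"
  shows "(w has_real_derivative D) (at t within I)"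
  unfolding has_field_derivative_iff tendsto_def
proof (intro allI impI)
  fix S :: "real set" assume S: "open S" "D \<in> S"
  have "\<forall>\<^sub>F s in at t within I. (u s - u t) / (s - t) \<in> S"
    using assms(1) S unfolding has_field_derivative_iff tendsto_def by blast
  moreover have "\<forall>\<^sub>F s in at t within I. (v s - v t) / (s - t) \<in> S"
    using assms(2) S unfolding has_field_derivative_iff tendsto_def by blast
  ultimately show "\<forall>\<^sub>F s in at t within I. (w s - w t) / (s - t) \<in> S"
    using assms(5) by eventually_elim (use assms(3,4) in auto)
qed

lemma eventually_neq_if_tendsto:
  fixes a b :: "'a :: t2_space"
  assumes "(f \<longlongrightarrow> a) G" "(g \<longlongrightarrow> b) G" "a \<noteq> b"
  shows "\<forall>\<^sub>F s in G. f s \<noteq> g s"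
proof -
  obtain S T where ST: "open S" "open T" "a \<in> S" "b \<in> T" "S \<inter> T = {}" using hausdorff[OF assms(3)] by blast
  show ?thesis
    using topological_tendstoD[OF assms(1) ST(1,3)] topological_tendstoD[OF assms(2) ST(2,4)]
    by eventually_elim (use ST in auto)
qed

text \<open>Where \<open>W\<close> differs from one of the two solutions, continuity makes it follow
  the other one locally. Where all three share a finite value \<open>a\<close>, both solutions have
  slope F(t,a), so switching does no harm. Minimum and maximum are the intended selections.\<close>

lemma esol_select:
  assumes U: "esol F I U" and V: "esol F I V" and W: "continuous_on I W"
    and sel: "\<And>t. t \<in> I \<Longrightarrow> W t = U t \<or> W t = V t"
  shows "esol F I W"
  unfolding esol_def
proof (intro conjI W ballI allI impI)
  fix t a assume t: "t \<in> I" and a: "W t = ereal a"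
  have I: "\<forall>\<^sub>F s in at t within I. s \<in> I" by (simp add: eventually_at_filter)
  have eq: "((\<lambda>s. real_of_ereal (W s)) has_real_derivative F (t, a)) (at t within I)"
    if X: "esol F I X" and Y: "esol F I Y" and WX: "W t = X t" and ne: "W t \<noteq> Y t"
      and XY: "\<And>s. s \<in> I \<Longrightarrow> W s = X s \<or> W s = Y s" for X Y
  proof -
    have "\<forall>\<^sub>F s in at t within I. W s \<noteq> Y s"
      using W Y t ne unfolding esol_def continuous_on_def by (blast intro: eventually_neq_if_tendsto)
    then have "\<forall>\<^sub>F s in at t within I. real_of_ereal (W s) = real_of_ereal (X s)"
      using I by eventually_elim (use XY in force)
    moreover have "((\<lambda>s. real_of_ereal (X s)) has_real_derivative F (t, a)) (at t within I)"
      using X t a WX unfolding esol_def by auto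
    ultimately show ?thesis
      using WX by (subst has_field_derivative_cong_eventually) auto
  qed
  consider "W t = U t" "W t \<noteq> V t" | "W t = V t" "W t \<noteq> U t" | "W t = U t" "W t = V t"
    using sel[OF t] by blast
  then show "((\<lambda>s. real_of_ereal (W s)) has_real_derivative F (t, a)) (at t within I)"
  proof cases
    case 1 then show ?thesis using eq[OF U V] sel by blast
  next
    case 2 then show ?thesis using eq[OF V U] sel by blast
  next
    case 3
    show ?thesis
    proof (rule has_derivative_select)
      show "((\<lambda>s. real_of_ereal (U s)) has_real_derivative F (t, a)) (at t within I)"
        "((\<lambda>s. real_of_ereal (V s)) has_real_derivative F (t, a)) (at t within I)"
        using U V t a 3 unfolding esol_def by auto
      show "\<forall>\<^sub>F s in at t within I. real_of_ereal (W s) = real_of_ereal (U s) \<or> real_of_ereal (W s) = real_of_ereal (V s)"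
        using I by eventually_elim (use sel in force)
    qed (use 3 in auto)
  qed
qed

lemma esol_min: "esol F I U \<Longrightarrow> esol F I V \<Longrightarrow> esol F I (\<lambda>t. min (U t) (V t))"
  by (rule esol_select[of F I U V]) (auto simp: esol_def min_def intro!: continuous_on_min[unfolded min_def])

lemma esol_max: "esol F I U \<Longrightarrow> esol F I V \<Longrightarrow> esol F I (\<lambda>t. max (U t) (V t))"
  by (rule esol_select[of F I U V]) (auto simp: esol_def max_def intro!: continuous_on_max[unfolded max_def])

section \<open>Integral form of the equation and pointwise limits\<close>

lemma continuous_bounded_on_box:
  fixes F :: "real \<times> real \<Rightarrow> real"
  assumes "continuous_on UNIV F"
  obtains M where "0 < M" "\<And>r v. r \<in> {p..q} \<Longrightarrow> \<bar>v\<bar> \<le> R \<Longrightarrow> \<bar>F (r, v)\<bar> \<le> M"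
proof -
  have "compact (F ` ({p..q} \<times> {-R..R}))"
    using assms by (intro compact_continuous_image compact_Times) (auto intro: continuous_on_subset)
  then obtain M where M: "0 < M" "\<forall>z\<in>F ` ({p..q} \<times> {-R..R}). norm z \<le> M"
    using compact_imp_bounded bounded_pos by metis
  show thesis
  proof (rule that[OF M(1)])
    fix r v assume "r \<in> {p..q}" "\<bar>v\<bar> \<le> R"
    then have "(r, v) \<in> {p..q} \<times> {-R..R}" by auto
    then show "\<bar>F (r, v)\<bar> \<le> M" using M(2) by (metis imageI real_norm_def)
  qed
qed

lemma continuous_on_ode_rhs:
  fixes F :: "real \<times> real \<Rightarrow> real"
  assumes "continuous_on UNIV F" "continuous_on S u"
  shows "continuous_on S (\<lambda>r. F (r, u r))"
  by (rule continuous_on_compose2[OF assms(1)]) (auto intro!: continuous_intros assms(2))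

lemma has_integral_if_ode:
  assumes "finite S" "p \<le> q" "continuous_on {p..q} u"
    and "\<And>r. r \<in> {p<..<q} - S \<Longrightarrow> (u has_real_derivative F (r, u r)) (at r)"
  shows "((\<lambda>r. F (r, u r)) has_integral (u q - u p)) {p..q}"
  using assms
  by (intro fundamental_theorem_of_calculus_interior_strong[of S])
     (auto simp: has_real_derivative_iff_has_vector_derivative)

lemma ode_if_integral:
  assumes F: "continuous_on UNIV F" and u: "continuous_on {p..q} u"
    and eq: "\<And>t. t \<in> {p..q} \<Longrightarrow> u t = u p + integral {p..t} (\<lambda>r. F (r, u r))"
    and t: "t \<in> {p..q}"
  shows "(u has_real_derivative F (t, u t)) (at t within {p..q})"
proof -
  have "((\<lambda>t. integral {p..t} (\<lambda>r. F (r, u r))) has_real_derivative F (t, u t)) (at t within {p..q})"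
    by (rule integral_has_real_derivative[OF continuous_on_ode_rhs[OF F u] t])
  then have "((\<lambda>t. u p + integral {p..t} (\<lambda>r. F (r, u r))) has_real_derivative 0 + F (t, u t)) (at t within {p..q})"
    by (intro DERIV_add DERIV_const)
  then show ?thesis
    unfolding add_0 by (rule has_field_derivative_transform_within[of _ _ _ _ 1]) (use t in \<open>auto intro: eq[symmetric]\<close>)
qed

text \<open>The integral equation does not see finitely many points, and for continuous
  \<open>u\<close> it returns the derivative at every point, end points included. This settles the
  junction when two solutions are glued.\<close>

lemma ode_removable_exceptions:
  assumes F: "continuous_on UNIV F" and u: "continuous_on {p..q} u" and S: "finite S"
    and der: "\<And>r. r \<in> {p<..<q} - S \<Longrightarrow> (u has_real_derivative F (r, u r)) (at r)"
    and t: "t \<in> {p..q}"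
  shows "(u has_real_derivative F (t, u t)) (at t within {p..q})"
proof (rule ode_if_integral[OF F u _ t])
  fix t assume "t \<in> {p..q}"
  then have "((\<lambda>r. F (r, u r)) has_integral (u t - u p)) {p..t}"
    using der by (intro has_integral_if_ode[OF S]) (auto intro: continuous_on_subset[OF u])
  then show "u t = u p + integral {p..t} (\<lambda>r. F (r, u r))"
    by (simp add: integral_unique)
qed

text \<open>Allows derivatives on the half-line to be computed on a compact window, which becomes
  one-sided when \<open>c\<close> is the initial time.\<close>

lemma at_within_atLeast_eq:
  fixes x c d :: real
  assumes "x \<le> c" "0 < d"
  shows "at c within {max x (c - d)..c + d} = at c within {x..}"
  by (rule at_within_nhd[of c "{c - d<..<c + d}"]) (use assms in auto)

text \<open>The truncations of \<open>W\<close> inherit the common Lipschitz constant, hence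
  \<open>W\<close> is continuous. Near a time where \<open>W\<close> is finite, all late
  \<open>U n\<close> stay strictly inside one truncation level on a common window. There they solve
  the integral equation classically, and dominated convergence passes it to the limit.\<close>

theorem esol_limit:
  assumes F: "continuous_on UNIV F" and U: "\<And>n. esol F {x..} (U n)"
    and lim: "\<And>t. x \<le> t \<Longrightarrow> (\<lambda>n. U n t) \<longlonglongrightarrow> W t"
  shows "esol F {x..} W"
  unfolding esol_def
proof (intro conjI ballI allI impI)
  have climp: "(\<lambda>n. clip R (U n t)) \<longlonglongrightarrow> clip R (W t)" if "x \<le> t" for R t
    using tendsto_clip[OF lim[OF that]] .
  have lip: "\<bar>clip R (W t) - clip R (W s)\<bar> \<le> M * \<bar>t - s\<bar>"
    if R: "0 \<le> R" and M: "\<And>r v. r \<in> {p..q} \<Longrightarrow> \<bar>v\<bar> \<le> R \<Longrightarrow> \<bar>F (r, v)\<bar> \<le> M"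
      and st: "s \<in> {x..} \<inter> {p..q}" "t \<in> {x..} \<inter> {p..q}" for R M p q s t
  proof (rule LIMSEQ_le_const2)
    show "(\<lambda>n. \<bar>clip R (U n t) - clip R (U n s)\<bar>) \<longlonglongrightarrow> \<bar>clip R (W t) - clip R (W s)\<bar>"
      using st by (intro tendsto_intros climp) auto
    show "\<exists>N. \<forall>n\<ge>N. \<bar>clip R (U n t) - clip R (U n s)\<bar> \<le> M * \<bar>t - s\<bar>"
      using esol_clip_lipschitz[OF U is_interval_ci R M st] by blast
  qed
  show "continuous_on {x..} W"
    unfolding continuous_on_def
  proof (intro ballI tendsto_if_tendsto_clip)
    fix t R :: real assume t: "t \<in> {x..}" and R: "0 < R"
    obtain M where M: "0 < M" "\<And>r v. r \<in> {t - 1..t + 1} \<Longrightarrow> \<bar>v\<bar> \<le> R \<Longrightarrow> \<bar>F (r, v)\<bar> \<le> M"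
      using continuous_bounded_on_box[OF F] by blast
    have "((\<lambda>s. clip R (W s) - clip R (W t)) \<longlongrightarrow> 0) (at t within {x..})"
    proof (rule Lim_null_comparison)
      show "((\<lambda>s. M * \<bar>s - t\<bar>) \<longlongrightarrow> 0) (at t within {x..})"
        by (rule tendsto_eq_intros refl | simp)+
      have "\<forall>\<^sub>F s in at t within {x..}. s \<in> {x..} \<and> dist s t < 1"
        unfolding eventually_at by (intro exI[of _ 1]) auto
      then show "\<forall>\<^sub>F s in at t within {x..}. norm (clip R (W s) - clip R (W t)) \<le> M * \<bar>s - t\<bar>"
      proof eventually_elim
        case (elim s)
        then show ?case
          using t R by (auto simp: dist_real_def intro!: lip[OF _ M(2)])
      qed
    qed
    then show "((\<lambda>s. clip R (W s)) \<longlongrightarrow> clip R (W t)) (at t within {x..})"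
      by (simp add: Lim_null[symmetric])
  qed
  fix c a assume c: "c \<in> {x..}" and a: "W c = ereal a"
  \<comment> \<open>The margin 1 above |a| absorbs two errors: less than 1/4 from the convergence at
    \<open>c\<close>, and at most 1/4 from the drift over the window.\<close>
  define R where "R = \<bar>a\<bar> + 1"
  have R: "0 \<le> R" and ca: "clip R (W c) = a" unfolding R_def a clip_ereal by auto
  obtain M where M: "0 < M" "\<And>r v. r \<in> {c - 1..c + 1} \<Longrightarrow> \<bar>v\<bar> \<le> R \<Longrightarrow> \<bar>F (r, v)\<bar> \<le> M"
    using continuous_bounded_on_box[OF F] by blast
  \<comment> \<open>Width at most 1 keeps the window where \<open>M\<close> bounds F; the factor
    1/(4M) limits the drift of a function with Lipschitz constant \<open>M\<close> to 1/4.\<close>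
  define d where "d = min 1 (1 / (4 * M))"
  have d: "0 < d" "d \<le> 1" "M * d \<le> 1/4"
    using M(1) by (auto simp: d_def min_def field_simps)
  define p where "p = max x (c - d)"
  define q where "q = c + d"
  have pq: "p \<le> c" "c < q" "x \<le> p" "p < q" using c d by (auto simp: p_def q_def)
  have lipU: "\<bar>clip R (U n t) - clip R (U n s)\<bar> \<le> M * \<bar>t - s\<bar>"
    if "s \<in> {x..} \<inter> {c - 1..c + 1}" "t \<in> {x..} \<inter> {c - 1..c + 1}" for n s t
    using esol_clip_lipschitz[where p = "c - 1" and q = "c + 1", OF U is_interval_ci R M(2)] that by blast
  have lipW: "\<bar>clip R (W t) - clip R (W s)\<bar> \<le> M * \<bar>t - s\<bar>"
    if "s \<in> {x..} \<inter> {c - 1..c + 1}" "t \<in> {x..} \<inter> {c - 1..c + 1}" for s t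
    using lip[where p = "c - 1" and q = "c + 1", OF R M(2)] that by blast
  have near: "r \<in> {x..} \<inter> {c - 1..c + 1}" "M * \<bar>r - c\<bar> \<le> 1/4" if "r \<in> {p..q}" for r
  proof -
    have "\<bar>r - c\<bar> \<le> d" using that d by (auto simp: p_def q_def)
    then have "M * \<bar>r - c\<bar> \<le> M * d" using M by simp
    then show "M * \<bar>r - c\<bar> \<le> 1/4" using d by simp
    show "r \<in> {x..} \<inter> {c - 1..c + 1}" using that d by (auto simp: p_def q_def)
  qed
  obtain N where N: "\<And>n. n \<ge> N \<Longrightarrow> \<bar>clip R (U n c) - a\<bar> < 1/4"
    using climp[of c R] c unfolding ca LIMSEQ_def dist_real_def
    by (metis atLeast_iff zero_less_divide_1_iff zero_less_numeral)
  have cpq: "c \<in> {p..q}" using pq by simp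
  \<comment> \<open>The shift by \<open>N\<close> discards the functions that are not yet close to
    \<open>a\<close> at time \<open>c\<close>.\<close>
  let ?g = "\<lambda>n r. clip R (U (n + N) r)" and ?w = "\<lambda>r. clip R (W r)"
  have gR: "\<bar>?g n r\<bar> < R" if r: "r \<in> {p..q}" for n r
  proof -
    have "\<bar>?g n r - ?g n c\<bar> \<le> M * \<bar>r - c\<bar>"
      by (rule lipU[OF near(1)[OF cpq] near(1)[OF r]])
    then have "\<bar>?g n r - ?g n c\<bar> \<le> 1/4" using near(2)[OF r] by (rule order_trans)
    then show ?thesis using N[OF le_add2, of n] R_def by linarith
  qed
  have wR: "\<bar>?w r\<bar> < R" if r: "r \<in> {p..q}" for r
  proof -
    have "\<bar>?w r - ?w c\<bar> \<le> M * \<bar>r - c\<bar>"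
      by (rule lipW[OF near(1)[OF cpq] near(1)[OF r]])
    then have "\<bar>?w r - ?w c\<bar> \<le> 1/4" using near(2)[OF r] by (rule order_trans)
    then show ?thesis using R_def ca by linarith
  qed
  have gcont: "continuous_on {p..q} (?g n)" for n
    using U[of "n + N"] pq unfolding esol_def by (auto intro!: continuous_on_clip intro: continuous_on_subset)
  have gder: "(?g n has_real_derivative F (r, ?g n r)) (at r)" if r: "r \<in> {p<..<q}" for n r
  proof -
    have "(?g n has_real_derivative F (r, ?g n r)) (at r within {x..})"
      using r pq gR by (intro esol_has_derivative_clip[OF U]) auto
    moreover have "r \<in> interior {x..}" using r pq by auto
    ultimately show ?thesis by (metis at_within_interior)
  qed
  have wcont: "continuous_on {p..q} ?w"
  proof (rule lipschitz_on_continuous_on[of M], rule lipschitz_onI)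
    fix r s assume "r \<in> {p..q}" "s \<in> {p..q}"
    then show "dist (?w r) (?w s) \<le> M * dist r s"
      unfolding dist_real_def using near(1) by (intro lipW)
  qed (use M in simp)
  have weq: "?w t = ?w p + integral {p..t} (\<lambda>r. F (r, ?w r))" if t: "t \<in> {p..q}" for t
  proof -
    have gint: "((\<lambda>r. F (r, ?g n r)) has_integral (?g n t - ?g n p)) {p..t}" for n
      using t gder by (intro has_integral_if_ode[of "{}"]) (auto intro: continuous_on_subset[OF gcont])
    have "(\<lambda>n. integral {p..t} (\<lambda>r. F (r, ?g n r))) \<longlonglongrightarrow> integral {p..t} (\<lambda>r. F (r, ?w r))"
    proof (rule dominated_convergence(2)[where h = "\<lambda>_. M"])
      fix n r assume r: "r \<in> {p..t}"
      then have rpq: "r \<in> {p..q}" using t by auto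
      show "norm (F (r, ?g n r)) \<le> M"
        using M(2)[of r "?g n r"] near(1)[OF rpq] gR[OF rpq, of n] by simp
    next
      fix r assume r: "r \<in> {p..t}"
      have "(\<lambda>n. (r, ?g n r)) \<longlonglongrightarrow> (r, ?w r)"
        using r pq by (intro tendsto_Pair tendsto_const LIMSEQ_ignore_initial_segment climp) auto
      moreover have "isCont F (r, ?w r)" using F by (simp add: continuous_on_eq_continuous_at)
      ultimately show "(\<lambda>n. F (r, ?g n r)) \<longlonglongrightarrow> F (r, ?w r)" by (rule isCont_tendsto_compose[rotated])
    qed (rule has_integral_integrable[OF gint], rule integrable_const_ivl)
    then have "(\<lambda>n. ?g n t - ?g n p) \<longlonglongrightarrow> integral {p..t} (\<lambda>r. F (r, ?w r))"
      unfolding integral_unique[OF gint] .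
    moreover have "(\<lambda>n. ?g n t - ?g n p) \<longlonglongrightarrow> ?w t - ?w p"
      using t pq by (intro tendsto_diff LIMSEQ_ignore_initial_segment climp) auto
    ultimately have "?w t - ?w p = integral {p..t} (\<lambda>r. F (r, ?w r))" by (rule LIMSEQ_unique[rotated])
    then show ?thesis by simp
  qed
  have "(?w has_real_derivative F (c, ?w c)) (at c within {p..q})"
    by (rule ode_if_integral[OF F wcont weq cpq])
  then have der: "(?w has_real_derivative F (c, a)) (at c within {p..q})" unfolding ca .
  have "((\<lambda>s. real_of_ereal (W s)) has_real_derivative F (c, a)) (at c within {p..q})"
  proof (rule has_field_derivative_transform_within[OF der, of 1])
    fix r assume "r \<in> {p..q}"
    then show "?w r = real_of_ereal (W r)" by (metis wR clip_inner real_of_ereal.simps(1))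
  qed (use pq in auto)
  then show "((\<lambda>s. real_of_ereal (W s)) has_real_derivative F (c, a)) (at c within {x..})"
    using at_within_atLeast_eq[of x c d] c d(1) unfolding p_def q_def by simp
qed

text \<open>The minima of the first n+1 functions are solutions and decrease to the infimum, so the
  limit theorem applies.\<close>

lemma esol_INF:
  assumes F: "continuous_on UNIV F" and U: "\<And>n::nat. esol F {x..} (U n)"
  shows "esol F {x..} (\<lambda>t. INF n. U n t)"
proof (rule esol_limit[OF F])
  show "esol F {x..} (\<lambda>t. INF i\<in>{..n}. U i t)" for n
  proof (induction n)
    case (Suc n)
    then show ?case using esol_min[OF U[of "Suc n"]] by (simp add: atMost_Suc inf_min)
  qed (use U in simp)
  fix t assume "x \<le> t"
  have "decseq (\<lambda>n. INF i\<in>{..n}. U i t)"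
    by (intro decseq_SucI INF_superset_mono) auto
  then have "(\<lambda>n. INF i\<in>{..n}. U i t) \<longlonglongrightarrow> (INF n. INF i\<in>{..n}. U i t)" by (rule LIMSEQ_INF)
  also have "(INF n. INF i\<in>{..n}. U i t) = (INF n. U n t)"
    by (intro antisym INF_greatest; meson INF_lower INF_lower2 UNIV_I atMost_iff order_refl)
  finally show "(\<lambda>n. INF i\<in>{..n}. U i t) \<longlonglongrightarrow> (INF n. U n t)" .
qed

lemma esol_SUP:
  assumes F: "continuous_on UNIV F" and U: "\<And>n::nat. esol F {x..} (U n)"
  shows "esol F {x..} (\<lambda>t. SUP n. U n t)"
proof (rule esol_limit[OF F])
  show "esol F {x..} (\<lambda>t. SUP i\<in>{..n}. U i t)" for n
  proof (induction n)
    case (Suc n)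
    then show ?case using esol_max[OF U[of "Suc n"]] by (simp add: atMost_Suc sup_max)
  qed (use U in simp)
  fix t assume "x \<le> t"
  have "incseq (\<lambda>n. SUP i\<in>{..n}. U i t)"
    by (intro incseq_SucI SUP_subset_mono) auto
  then have "(\<lambda>n. SUP i\<in>{..n}. U i t) \<longlonglongrightarrow> (SUP n. SUP i\<in>{..n}. U i t)" by (rule LIMSEQ_SUP)
  also have "(SUP n. SUP i\<in>{..n}. U i t) = (SUP n. U n t)"
    by (intro antisym SUP_least; meson SUP_upper SUP_upper2 UNIV_I atMost_iff order_refl)
  finally show "(\<lambda>n. SUP i\<in>{..n}. U i t) \<longlonglongrightarrow> (SUP n. U n t)" .
qed

section \<open>Local existence\<close>

text \<open>Delaying the argument by \<open>h\<close> makes the integral equation solvable by finitely many iterations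
  (Tonelli's scheme).\<close>

lemma delayed_integral_equation:
  fixes G :: "real \<times> real \<Rightarrow> real"
  assumes G: "continuous_on UNIV G" and h: "0 < h"
  obtains f where "continuous_on {b..c} f"
    "\<And>t. t \<in> {b..c} \<Longrightarrow> f t = L + integral {b..t} (\<lambda>s. G (s, f (max b (s - h))))"
proof -
  define T where "T f t = L + integral {b..t} (\<lambda>s. G (s, f (max b (s - h))))" for f t
  define f where "f k = (T ^^ k) (\<lambda>_. L)" for k
  have cont: "continuous_on {b..c} (T f)" if f: "continuous_on {b..c} f" for f
  proof -
    have "continuous_on {b..c} (\<lambda>s. f (max b (s - h)))"
      by (rule continuous_on_compose2[OF f]) (use h in \<open>auto intro!: continuous_intros\<close>)
    then have "(\<lambda>s. G (s, f (max b (s - h)))) integrable_on {b..c}"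
      by (intro integrable_continuous_interval continuous_on_ode_rhs[OF G])
    then show ?thesis
      unfolding T_def by (intro continuous_intros indefinite_integral_continuous_1)
  qed
  have fcont: "continuous_on {b..c} (f k)" for k
    by (induction k) (auto simp: f_def intro: cont)
  \<comment> \<open>On [b, b+(k+1)h] the right-hand side reads \<open>f\<close> only on [b, b+kh],
    so each iteration makes one more delay interval final. At k = 0 only t = b is concerned, where
    the integral vanishes.\<close>
  have stable: "f (Suc k) t = f k t" if "b \<le> t" "t \<le> b + real k * h" for k t
    using that
  proof (induction k arbitrary: t)
    case 0
    then show ?case by (simp add: f_def T_def)
  next
    case (Suc k)
    have "f (Suc k) (max b (s - h)) = f k (max b (s - h))" if "s \<in> {b..t}" for s
      using that Suc.prems h by (intro Suc.IH) (auto simp: algebra_simps)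
    then have "integral {b..t} (\<lambda>s. G (s, f (Suc k) (max b (s - h)))) = integral {b..t} (\<lambda>s. G (s, f k (max b (s - h))))"
      by (intro integral_cong) simp
    then have "T (f (Suc k)) t = T (f k) t" by (simp add: T_def)
    then show ?case by (simp add: f_def)
  qed
  obtain k where k: "c - b \<le> real k * h"
    using h by (metis real_arch_simple pos_divide_le_eq)
  show thesis
  proof (rule that[OF fcont[of k]])
    fix t assume t: "t \<in> {b..c}"
    then have "f k t = f (Suc k) t" using stable[of t k] k by simp
    also have "\<dots> = T (f k) t" by (simp add: f_def)
    finally show "f k t = L + integral {b..t} (\<lambda>s. G (s, f k (max b (s - h))))" by (simp add: T_def)
  qed
qed

text \<open>The delayed solutions are all \<open>M\<close>-Lipschitz and start at \<open>L\<close>,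
  so Arzela-Ascoli gives a uniformly convergent subsequence. The delay changes the argument of G by
  at most M times \<open>h n\<close>, and it disappears in the limit. A bound on G for all
  \<open>v\<close> is what gives a solution on the whole of [b,c].\<close>

lemma peano_existence_bounded:
  fixes G :: "real \<times> real \<Rightarrow> real"
  assumes G: "continuous_on UNIV G" and M: "\<And>s v. s \<in> {b..c} \<Longrightarrow> \<bar>G (s, v)\<bar> \<le> M" and bc: "b \<le> c"
  obtains u where "u b = L" "\<And>t. t \<in> {b..c} \<Longrightarrow> (u has_real_derivative G (t, u t)) (at t within {b..c})"
proof -
  define h where "h n = 1 / real (Suc n)" for n
  have h: "0 < h n" for n by (simp add: h_def)
  have h0: "h \<longlonglongrightarrow> 0" unfolding h_def using LIMSEQ_inverse_real_of_nat by (simp add: inverse_eq_divide)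
  have "\<exists>f. continuous_on {b..c} f \<and>
      (\<forall>t\<in>{b..c}. f t = L + integral {b..t} (\<lambda>s. G (s, f (max b (s - h n)))))" for n
    using delayed_integral_equation[OF G h] by metis
  then obtain f where fcont: "\<And>n. continuous_on {b..c} (f n)"
    and feq: "\<And>n t. t \<in> {b..c} \<Longrightarrow> f n t = L + integral {b..t} (\<lambda>s. G (s, f n (max b (s - h n))))"
    by metis
  let ?d = "\<lambda>n s. G (s, f n (max b (s - h n)))"
  have dcont: "continuous_on {b..c} (?d n)" for n
    by (intro continuous_on_ode_rhs[OF G] continuous_on_compose2[OF fcont])
       (use h[of n] in \<open>auto intro!: continuous_intros\<close>)
  have fder: "(f n has_real_derivative ?d n t) (at t within {b..c})" if t: "t \<in> {b..c}" for n t
  proof -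
    have "((\<lambda>t. L + integral {b..t} (?d n)) has_real_derivative 0 + ?d n t) (at t within {b..c})"
      by (intro DERIV_add DERIV_const integral_has_real_derivative dcont t)
    then show ?thesis
      unfolding add_0 by (rule has_field_derivative_transform_within[of _ _ _ _ 1])
        (use t in \<open>auto intro: feq[symmetric]\<close>)
  qed
  have M0: "0 \<le> M" using M[of b 0] bc by (simp add: order_trans[OF abs_ge_zero])
  have lip: "\<bar>f n s - f n t\<bar> \<le> M * \<bar>s - t\<bar>" if "s \<in> {b..c}" "t \<in> {b..c}" for n s t
    using field_differentiable_bound[of "{b..c}" "f n" "?d n" M s t] fder M that by auto
  have fb: "f n b = L" for n using feq[of b n] bc by simp
  obtain g k where gcont: "continuous_on {b..c} g" and k: "strict_mono (k :: nat \<Rightarrow> nat)"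
    and unif: "\<And>e. 0 < e \<Longrightarrow> \<exists>N. \<forall>n x. n \<ge> N \<and> x \<in> {b..c} \<longrightarrow> norm (f (k n) x - g x) < e"
  proof (rule Arzela_Ascoli[of "{b..c}" f "\<bar>L\<bar> + M * (c - b)"])
    fix n t assume t: "t \<in> {b..c}"
    have "\<bar>f n t - L\<bar> \<le> M * \<bar>t - b\<bar>" using lip[of t b n] t fb by simp
    also have "\<dots> \<le> M * (c - b)" using t M0 by (intro mult_left_mono) auto
    finally show "norm (f n t) \<le> \<bar>L\<bar> + M * (c - b)" by simp
  next
    fix t e :: real assume t: "t \<in> {b..c}" and e: "0 < e"
    show "\<exists>d>0. \<forall>n s. s \<in> {b..c} \<and> norm (t - s) < d \<longrightarrow> norm (f n t - f n s) < e"
    proof (intro exI conjI allI impI)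
      \<comment> \<open>M + 1 instead of M, since M may be 0.\<close>
      show "0 < e / (M + 1)" using e M0 by simp
      fix n s assume s: "s \<in> {b..c} \<and> norm (t - s) < e / (M + 1)"
      have "\<bar>f n t - f n s\<bar> \<le> M * \<bar>t - s\<bar>" using lip s t by blast
      also have "\<dots> \<le> (M + 1) * \<bar>t - s\<bar>" by (intro mult_right_mono) auto
      also have "\<dots> < e" using s M0 by (simp add: field_simps)
      finally show "norm (f n t - f n s) < e" by simp
    qed
  qed auto
  have conv: "(\<lambda>n. f (k n) t) \<longlonglongrightarrow> g t" if "t \<in> {b..c}" for t
    unfolding LIMSEQ_def dist_norm using unif that by blast
  have dconv: "(\<lambda>n. ?d (k n) t) \<longlonglongrightarrow> G (t, g t)" if t: "t \<in> {b..c}" for t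
  proof -
    have "(\<lambda>n. f (k n) (max b (t - h (k n))) - f (k n) t) \<longlonglongrightarrow> 0"
    proof (rule Lim_null_comparison)
      show "\<forall>\<^sub>F n in sequentially. norm (f (k n) (max b (t - h (k n))) - f (k n) t) \<le> M * h (k n)"
      proof (intro always_eventually allI)
        fix n
        have "max b (t - h (k n)) \<in> {b..c}" using t h[of "k n"] by auto
        then have "norm (f (k n) (max b (t - h (k n))) - f (k n) t) \<le> M * \<bar>max b (t - h (k n)) - t\<bar>"
          using lip t by simp
        also have "\<dots> \<le> M * h (k n)" using M0 t h[of "k n"] by (intro mult_left_mono) auto
        finally show "norm (f (k n) (max b (t - h (k n))) - f (k n) t) \<le> M * h (k n)" .
      qed
      have "(\<lambda>n. h (k n)) \<longlonglongrightarrow> 0" using LIMSEQ_subseq_LIMSEQ[OF h0 k] by (simp add: o_def)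
      then show "(\<lambda>n. M * h (k n)) \<longlonglongrightarrow> 0" by (rule tendsto_mult_right_zero)
    qed
    from tendsto_add[OF this conv[OF t]]
    have "(\<lambda>n. f (k n) (max b (t - h (k n)))) \<longlonglongrightarrow> g t" by simp
    then have "(\<lambda>n. (t, f (k n) (max b (t - h (k n))))) \<longlonglongrightarrow> (t, g t)" by (intro tendsto_intros)
    moreover have "isCont G (t, g t)" using G by (simp add: continuous_on_eq_continuous_at)
    ultimately show ?thesis by (rule isCont_tendsto_compose[rotated])
  qed
  have gb: "g b = L" using conv[of b] bc fb by (simp add: LIMSEQ_const_iff)
  have geq: "g t = g b + integral {b..t} (\<lambda>s. G (s, g s))" if t: "t \<in> {b..c}" for t
  proof -
    have "(\<lambda>n. integral {b..t} (?d (k n))) \<longlonglongrightarrow> integral {b..t} (\<lambda>s. G (s, g s))"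
    proof (rule dominated_convergence(2)[where h = "\<lambda>_. M"])
      show "?d (k n) integrable_on {b..t}" for n
        using t by (intro integrable_continuous_interval continuous_on_subset[OF dcont]) auto
      show "(\<lambda>_. M) integrable_on {b..t}" by (rule integrable_const_ivl)
      show "norm (?d (k n) s) \<le> M" if "s \<in> {b..t}" for n s using that t M by simp
      show "(\<lambda>n. ?d (k n) s) \<longlonglongrightarrow> G (s, g s)" if "s \<in> {b..t}" for s using that t by (intro dconv) auto
    qed
    then have "(\<lambda>n. L + integral {b..t} (?d (k n))) \<longlonglongrightarrow> L + integral {b..t} (\<lambda>s. G (s, g s))"
      by (intro tendsto_intros)
    moreover have "(\<lambda>n. L + integral {b..t} (?d (k n))) = (\<lambda>n. f (k n) t)"
      by (rule ext, rule feq[symmetric, OF t])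
    ultimately show ?thesis unfolding gb using LIMSEQ_unique conv[OF t] by metis
  qed
  show thesis
    by (rule that[OF gb ode_if_integral[OF G gcont geq]])
qed

theorem peano_existence:
  fixes F :: "real \<times> real \<Rightarrow> real"
  assumes F: "continuous_on UNIV F"
  obtains u d where "0 < d" "u b = L"
    "\<And>t. t \<in> {b..b + d} \<Longrightarrow> (u has_real_derivative F (t, u t)) (at t within {b..b + d})"
proof -
  define G where "G = (\<lambda>(s, v). F (s, max (L - 1) (min (L + 1) v)))"
  have G: "continuous_on UNIV G" unfolding G_def split_beta
    by (rule continuous_on_compose2[OF F]) (auto intro!: continuous_intros)
  obtain M where M: "0 < M" "\<And>r v. r \<in> {b..b + 1} \<Longrightarrow> \<bar>v\<bar> \<le> \<bar>L\<bar> + 1 \<Longrightarrow> \<bar>F (r, v)\<bar> \<le> M"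
    using continuous_bounded_on_box[OF F] by blast
  have "\<bar>G (s, v)\<bar> \<le> M" if "s \<in> {b..b + 1}" for s v
    unfolding G_def prod.case using that by (intro M(2)) (auto simp: max_def min_def)
  then obtain u where ub: "u b = L"
    and u: "\<And>t. t \<in> {b..b + 1} \<Longrightarrow> (u has_real_derivative G (t, u t)) (at t within {b..b + 1})"
    using peano_existence_bounded[OF G, of b "b + 1" M L] by auto
  have "continuous_on {b..b + 1} u" using u by (rule DERIV_continuous_on)
  then obtain d where d: "0 < d" "\<And>t. t \<in> {b..b + 1} \<Longrightarrow> dist t b < d \<Longrightarrow> dist (u t) (u b) < 1"
    unfolding continuous_on_iff by (metis atLeastAtMost_iff le_add_same_cancel1 order_refl zero_less_one zero_le_one)
  define e where "e = min 1 (d / 2)"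
  have e: "0 < e" "e \<le> 1" "e < d" using d by (auto simp: e_def)
  show thesis
  proof (rule that[of e u, OF e(1) ub])
    fix t assume t: "t \<in> {b..b + e}"
    then have t1: "t \<in> {b..b + 1}" using e by auto
    have "dist (u t) L < 1" using d(2)[OF t1] t e ub by (auto simp: dist_real_def)
    then have "G (t, u t) = F (t, u t)" by (simp add: G_def dist_real_def)
    then have "(u has_real_derivative F (t, u t)) (at t within {b..b + 1})" using u[OF t1] by simp
    then show "(u has_real_derivative F (t, u t)) (at t within {b..b + e})"
      by (rule DERIV_subset) (use e in auto)
  qed
qed

section \<open>Maximal solutions and blow-up\<close>

lemma right_solution_domE:
  assumes "right_solution F x y \<phi>"
  obtains "dom \<phi> = {x..}" | b where "x < b" "dom \<phi> = {x..<b}"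
proof -
  obtain b :: ereal where b: "ereal x < b" "dom \<phi> = {t. x \<le> t \<and> ereal t < b}"
    using assms unfolding right_solution_def by blast
  show thesis
  proof (cases b)
    case (real r)
    then show thesis using b by (intro that(2)[of r]) auto
  next
    case PInf
    then show thesis using b by (intro that(1)) auto
  next
    case MInf
    then show thesis using b by simp
  qed
qed

lemma right_solution_restrict:
  assumes F: "continuous_on UNIV F" and D: "D = {x..} \<or> (\<exists>b>x. D = {x..<b})"
    and v: "\<And>t. t \<in> D \<Longrightarrow> (v has_real_derivative F (t, v t)) (at t within D)" and y: "v x = y"
  shows "right_solution F x y ((\<lambda>t. Some (v t)) |` D)"
proof -
  let ?\<phi> = "(\<lambda>t. Some (v t)) |` D"
  have dom: "dom ?\<phi> = D" by (auto simp: restrict_map_def split: if_splits)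
  have app: "app ?\<phi> t = v t" if "t \<in> D" for t using that by simp
  have der: "(app ?\<phi> has_real_derivative F (t, app ?\<phi> t)) (at t within D)" if t: "t \<in> D" for t
    using has_field_derivative_transform_within[OF v[OF t], of 1 "app ?\<phi>"] t by simp
  have "continuous_on D (app ?\<phi>)" using der by (rule DERIV_continuous_on)
  then have "continuous_on D (\<lambda>t. F (t, app ?\<phi> t))" by (rule continuous_on_ode_rhs[OF F])
  then have "C1_on D (app ?\<phi>)" 
    unfolding C1_on_def using der by (intro exI[of _ "\<lambda>t. F (t, app ?\<phi> t)"]) auto
  moreover have "\<exists>b::ereal. ereal x < b \<and> D = {t. x \<le> t \<and> ereal t < b}"
    using D
  proof
    assume "D = {x..}"
    then show ?thesis by (intro exI[of _ \<infinity>]) auto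
  next
    assume "\<exists>b>x. D = {x..<b}"
    then obtain b where "x < b" "D = {x..<b}" by blast
    then show ?thesis by (intro exI[of _ "ereal b"]) auto
  qed
  moreover have "x \<in> D" using D by auto
  ultimately show ?thesis unfolding right_solution_def dom using der y by simp
qed

lemma right_solution_esol:
  assumes "right_solution F x y \<phi>"
  shows "esol F (dom \<phi>) (\<lambda>t. ereal (app \<phi> t))"
proof -
  have der: "(app \<phi> has_real_derivative F (t, app \<phi> t)) (at t within dom \<phi>)" if "t \<in> dom \<phi>" for t
    using assms that unfolding right_solution_def by blast
  then have "continuous_on (dom \<phi>) (app \<phi>)" by (rule DERIV_continuous_on)
  then show ?thesis unfolding esol_def using der by (auto intro: continuous_on_ereal)
qed

lemma has_lim_plus_iff:
  assumes "x < b" "dom \<phi> = {x..<b}"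
  shows "has_lim_plus \<phi> l \<longleftrightarrow> ((\<lambda>t. ereal (app \<phi> t)) \<longlongrightarrow> l) (at_left b)"
proof -
  have "Sup (ereal ` {x..<b}) = ereal b"
  proof (rule SUP_eqI)
    fix z assume z: "\<And>t. t \<in> {x..<b} \<Longrightarrow> ereal t \<le> z"
    show "ereal b \<le> z"
    proof (rule ccontr)
      assume "\<not> ereal b \<le> z"
      moreover have "ereal x \<le> z" using z[of x] assms(1) by simp
      ultimately obtain r where "z = ereal r" "x \<le> r" "r < b" by (cases z) auto
      then show False using z[of "(r + b) / 2"] by auto
    qed
  qed auto
  then show ?thesis
    unfolding has_lim_plus_def assms(2) by (simp add: at_left_ereal filterlim_filtermap)
qed

text \<open>Serves two continuations past \<open>b\<close>: by a local solution, with
  \<open>T\<close> a compact interval, and by a constant infinite value, with \<open>T\<close> a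
  half-line.\<close>

lemma continuous_on_glue_at_limit:
  fixes f g :: "real \<Rightarrow> 'a::topological_space"
  assumes f: "continuous_on {x..<b} f" and lim: "(f \<longlongrightarrow> g b) (at_left b)" and "x < b"
    and g: "continuous_on T g" and T: "closed T" "T \<subseteq> {b..}" "b \<in> T"
  shows "continuous_on ({x..b} \<union> T) (\<lambda>t. if t < b then f t else g t)"
proof (rule continuous_on_closed_Un)
  let ?w = "\<lambda>t. if t < b then f t else g t"
  show "continuous_on T ?w"
    using g by (rule continuous_on_eq) (use T in force)
  show "continuous_on {x..b} ?w"
    unfolding continuous_on_def
  proof
    fix t assume t: "t \<in> {x..b}"
    show "(?w \<longlongrightarrow> ?w t) (at t within {x..b})"
    proof (cases "t = b")
      case True
      have "(?w \<longlongrightarrow> g b) (at_left b)"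
        using lim by (rule Lim_transform_eventually) (auto simp: eventually_at_filter)
      moreover have "at b within {x..b} = at_left b"
        by (rule at_within_nhd[of b "{x<..}"]) (use \<open>x < b\<close> in auto)
      ultimately show ?thesis using True by simp
    next
      case False
      have "(f \<longlongrightarrow> f t) (at t within {x..<b})" using f t False unfolding continuous_on_def by auto
      then have "(?w \<longlongrightarrow> f t) (at t within {x..<b})"
        by (rule Lim_transform_eventually) (auto simp: eventually_at_filter)
      moreover have "at t within {x..<b} = at t within {x..b}"
        by (rule at_within_nhd[of t "{..<b}"]) (use t False in auto)
      ultimately show ?thesis using t False by simp
    qed
  qed
qed (use T in auto)

text \<open>Every truncation is Lipschitz up to \<open>b\<close> and so has a left limit.
  Compactness of the extended reals supplies one candidate \<open>l\<close> along a sequence, and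
  this identifies the limits of all truncations at once as \<open>clip R l\<close>.\<close>

lemma esol_left_limit:
  assumes F: "continuous_on UNIV F" and U: "esol F {x..<b} U" and xb: "x < b"
  obtains l where "(U \<longlongrightarrow> l) (at_left b)"
proof -
  define X where "X n = b - (b - x) / real (Suc (Suc n))" for n :: nat
  have "(\<lambda>n. (b - x) * inverse (real (Suc (Suc n)))) \<longlonglongrightarrow> (b - x) * 0"
    by (intro tendsto_mult tendsto_const filterlim_compose[OF LIMSEQ_inverse_real_of_nat filterlim_Suc])
  then have "X \<longlonglongrightarrow> b - 0"
    unfolding X_def by (intro tendsto_intros) (simp add: divide_inverse)
  moreover have "X n < b" for n using xb by (simp add: X_def)
  ultimately have X: "filterlim X (at_left b) sequentially"
    by (auto simp: filterlim_at eventually_sequentially less_imp_neq)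
  obtain l r where r: "strict_mono (r :: nat \<Rightarrow> nat)" and l: "((\<lambda>n. U (X n)) \<circ> r) \<longlonglongrightarrow> l"
    using compact_complete_linorder[of "\<lambda>n. U (X n)"] by blast
  have Xr: "filterlim (\<lambda>n. X (r n)) (at_left b) sequentially"
    using filterlim_compose[OF X filterlim_subseq[OF r]] .
  have "(U \<longlongrightarrow> l) (at_left b)"
  proof (rule tendsto_if_tendsto_clip)
    fix R :: real assume R: "0 < R"
    obtain M where M: "0 < M" "\<And>r v. r \<in> {x..b} \<Longrightarrow> \<bar>v\<bar> \<le> R \<Longrightarrow> \<bar>F (r, v)\<bar> \<le> M"
      using continuous_bounded_on_box[OF F] by blast
    have "M-lipschitz_on {x..<b} (\<lambda>t. clip R (U t))"
    proof (rule lipschitz_onI)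
      fix s t assume st: "s \<in> {x..<b}" "t \<in> {x..<b}"
      show "dist (clip R (U s)) (clip R (U t)) \<le> M * dist s t"
        unfolding dist_real_def
        by (rule esol_clip_lipschitz[OF U _ _ M(2)]) (use R st in \<open>auto simp: is_interval_co\<close>)
    qed (use M in simp)
    then have "uniformly_continuous_on {x..<b} (\<lambda>t. clip R (U t))"
      by (rule lipschitz_on_uniformly_continuous)
    moreover have "b \<in> closure {x..<b}" using xb by simp
    ultimately obtain m where m: "((\<lambda>t. clip R (U t)) \<longlongrightarrow> m) (at b within {x..<b})"
      using uniformly_continuous_on_extension_at_closure by blast
    have "at b within {x..<b} = at_left b"
      by (rule at_within_nhd[of b "{x<..}"]) (use xb in auto)
    with m have m: "((\<lambda>t. clip R (U t)) \<longlongrightarrow> m) (at_left b)" by simp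
    have "(\<lambda>n. clip R (U (X (r n)))) \<longlonglongrightarrow> m" by (rule filterlim_compose[OF m Xr])
    moreover have "(\<lambda>n. clip R (U (X (r n)))) \<longlonglongrightarrow> clip R l" using tendsto_clip[OF l] by (simp add: o_def)
    ultimately have "m = clip R l" by (rule LIMSEQ_unique)
    then show "((\<lambda>t. clip R (U t)) \<longlongrightarrow> clip R l) (at_left b)" using m by simp
  qed
  then show thesis by (rule that)
qed

text \<open>A local solution through (b,L) is glued on. At \<open>b\<close> the two pieces only give
  continuity; the derivative there comes from \<open>ode_removable_exceptions\<close>.\<close>

lemma right_solution_extend:
  assumes F: "continuous_on UNIV F" and \<phi>: "right_solution F x y \<phi>" and xb: "x < b" and dom: "dom \<phi> = {x..<b}"
    and lim: "(app \<phi> \<longlongrightarrow> L) (at_left b)"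
  obtains \<psi> where "right_solution F x y \<psi>" "\<phi> \<subseteq>\<^sub>m \<psi>" "\<psi> \<noteq> \<phi>"
proof -
  obtain u d where d: "0 < d" and ub: "u b = L"
    and u: "\<And>t. t \<in> {b..b + d} \<Longrightarrow> (u has_real_derivative F (t, u t)) (at t within {b..b + d})"
    using peano_existence[OF F] by blast
  define v where "v t = (if t < b then app \<phi> t else u t)" for t
  have der\<phi>: "(app \<phi> has_real_derivative F (t, app \<phi> t)) (at t within {x..<b})" if "t \<in> {x..<b}" for t
    using \<phi> that unfolding right_solution_def dom by blast
  have "continuous_on ({x..b} \<union> {b..b + d}) v"
    unfolding v_def
  proof (rule continuous_on_glue_at_limit)
    show "continuous_on {x..<b} (app \<phi>)" using der\<phi> by (rule DERIV_continuous_on)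
    show "continuous_on {b..b + d} u" using u by (rule DERIV_continuous_on)
    show "(app \<phi> \<longlongrightarrow> u b) (at_left b)" using lim ub by simp
  qed (use xb d in auto)
  moreover have "{x..b} \<union> {b..b + d} = {x..b + d}" using xb d by auto
  ultimately have vcont: "continuous_on {x..b + d} v" by simp
  have vder: "(v has_real_derivative F (r, v r)) (at r)" if r: "r \<in> {x<..<b + d} - {b}" for r
  proof (cases "r < b")
    case True
    have "(app \<phi> has_real_derivative F (r, v r)) (at r)"
      using der\<phi>[of r] r True at_within_interior[of r "{x..<b}"] by (simp add: v_def interior_atLeastLessThan)
    then show ?thesis
      by (rule has_field_derivative_transform_within_open[of _ _ _ "{..<b}"]) (use True in \<open>auto simp: v_def\<close>)
  next
    case False
    have "(u has_real_derivative F (r, v r)) (at r)"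
      using u[of r] r False at_within_interior[of r "{b..b + d}"] by (simp add: v_def)
    then show ?thesis
      by (rule has_field_derivative_transform_within_open[of _ _ _ "{b<..}"]) (use r False in \<open>auto simp: v_def\<close>)
  qed
  let ?\<psi> = "(\<lambda>t. Some (v t)) |` {x..<b + d}"
  have "right_solution F x y ?\<psi>"
  proof (rule right_solution_restrict[OF F])
    show "{x..<b + d} = {x..} \<or> (\<exists>c>x. {x..<b + d} = {x..<c})" using xb d by (intro disjI2 exI[of _ "b + d"]) auto
    show "v x = y" using \<phi> xb unfolding right_solution_def v_def by simp
    fix t assume "t \<in> {x..<b + d}"
    then have "(v has_real_derivative F (t, v t)) (at t within {x..b + d})"
      by (intro ode_removable_exceptions[OF F vcont, of "{b}"] vder) auto
    then show "(v has_real_derivative F (t, v t)) (at t within {x..<b + d})"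
      by (rule DERIV_subset) auto
  qed
  moreover have "\<phi> \<subseteq>\<^sub>m ?\<psi>"
    unfolding map_le_def
  proof
    fix t assume t: "t \<in> dom \<phi>"
    then obtain z where "\<phi> t = Some z" by blast
    then show "\<phi> t = ?\<psi> t" using t d unfolding dom by (simp add: v_def)
  qed
  moreover have "?\<psi> \<noteq> \<phi>"
  proof
    assume "?\<psi> = \<phi>"
    then have "\<phi> b = ?\<psi> b" by simp
    then have "b \<in> dom \<phi>" using xb d by (simp add: domIff)
    then show False unfolding dom by simp
  qed
  ultimately show thesis by (rule that)
qed

text \<open>The left limit at a finite end exists in the extended reals, and a finite one would
  contradict maximality. The continuation by the infinite constant is an extended solution because
  from \<open>b\<close> on only continuity is demanded.\<close>

theorem maximal_solution_global_or_blowup: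
  assumes F: "continuous_on UNIV F" and \<phi>: "\<phi> \<in> S_plus F x y"
  obtains "dom \<phi> = {x..}"
  | b l where "x < b" "dom \<phi> = {x..<b}" "\<bar>l\<bar> = \<infinity>" "has_lim_plus \<phi> l"
      "esol F {x..} (\<lambda>t. if t < b then ereal (app \<phi> t) else l)"
proof -
  have rs: "right_solution F x y \<phi>" using \<phi> unfolding S_plus_def by blast
  from rs show thesis
  proof (cases rule: right_solution_domE)
    case 1
    then show thesis by (rule that(1))
  next
    case (2 b)
    let ?U = "\<lambda>t. ereal (app \<phi> t)"
    have U: "esol F {x..<b} ?U" using right_solution_esol[OF rs] 2 by simp
    obtain l where l: "(?U \<longlongrightarrow> l) (at_left b)" using esol_left_limit[OF F U 2(1)] .
    have inf: "\<bar>l\<bar> = \<infinity>"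
    proof (rule ccontr)
      assume "\<bar>l\<bar> \<noteq> \<infinity>"
      then obtain L where "l = ereal L" by (cases l) auto
      then have "(app \<phi> \<longlongrightarrow> L) (at_left b)" using l by simp
      then show False
        using right_solution_extend[OF F rs 2] \<phi> unfolding S_plus_def by blast
    qed
    let ?V = "\<lambda>t. if t < b then ?U t else l"
    have "esol F {x..} ?V"
      unfolding esol_def
    proof (intro conjI ballI allI impI)
      have "continuous_on ({x..b} \<union> {b..}) ?V"
        by (rule continuous_on_glue_at_limit) (use U l 2 in \<open>auto simp: esol_def\<close>)
      moreover have "{x..b} \<union> {b..} = {x..}" using 2 by auto
      ultimately show "continuous_on {x..} ?V" by simp
      fix t a assume t: "t \<in> {x..}" and a: "?V t = ereal a"
      have tb: "t < b" using a inf by (auto split: if_splits)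
      have der: "((\<lambda>s. real_of_ereal (?U s)) has_real_derivative F (t, a)) (at t within {x..<b})"
        using U t tb a unfolding esol_def by auto
      have "((\<lambda>s. real_of_ereal (?V s)) has_real_derivative F (t, a)) (at t within {x..<b})"
        by (rule has_field_derivative_transform_within[OF der zero_less_one]) (use t tb in auto)
      moreover have "at t within {x..<b} = at t within {x..}"
        by (rule at_within_nhd[of t "{..<b}"]) (use t tb in auto)
      ultimately show "((\<lambda>s. real_of_ereal (?V s)) has_real_derivative F (t, a)) (at t within {x..})" by simp
    qed
    then show thesis using has_lim_plus_iff[OF 2] l by (intro that(2)[OF 2 inf]) auto
  qed
qed

text \<open>Maximality is automatic: every right solution lives inside [x,\<infinity>), so nothing
  can be added.\<close>

lemma esol_finite_G_plus:
  assumes F: "continuous_on UNIV F" and W: "esol F {x..} W" and y: "W x = ereal y"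
    and fin: "\<And>t. x \<le> t \<Longrightarrow> \<bar>W t\<bar> \<noteq> \<infinity>"
  shows "(F, x, y) \<in> G_plus"
proof -
  let ?\<phi> = "(\<lambda>t. Some (real_of_ereal (W t))) |` {x..}"
  have rs: "right_solution F x y ?\<phi>"
  proof (rule right_solution_restrict[OF F])
    fix t assume t: "t \<in> {x..}"
    then show "((\<lambda>t. real_of_ereal (W t)) has_real_derivative F (t, real_of_ereal (W t))) (at t within {x..})"
      using W fin[of t] unfolding esol_def by (simp add: ereal_real')
  qed (use y in auto)
  have dom: "dom ?\<phi> = {x..}" by (auto simp: restrict_map_def split: if_splits)
  have "\<psi> = ?\<phi>" if \<psi>: "right_solution F x y \<psi>" and le: "?\<phi> \<subseteq>\<^sub>m \<psi>" for \<psi>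
  proof (rule map_le_antisym[OF _ le])
    have "dom \<psi> \<subseteq> {x..}" using \<psi> by (cases rule: right_solution_domE) auto
    then show "\<psi> \<subseteq>\<^sub>m ?\<phi>" using le dom unfolding map_le_def by (metis subsetD)
  qed
  then have "?\<phi> \<in> S_plus F x y" unfolding S_plus_def using rs by blast
  then show ?thesis unfolding G_plus_def C_plane_def using F dom by blast
qed

text \<open>The way back from extended to maximal solutions. The times with infinite value form a
  closed set; cutting at its least element \<open>c\<close> discards any later return to finite
  values. An extension of the cut function would be continuous with a finite value at
  \<open>c\<close>, against the infinite limit.\<close>

lemma esol_first_infinity:
  assumes F: "continuous_on UNIV F" and W: "esol F {x..} W" and y: "W x = ereal y"
    and inf: "x \<le> t0" "\<bar>W t0\<bar> = \<infinity>"
  obtains c \<phi> where "x < c" "dom \<phi> = {x..<c}" "\<forall>t\<in>{x..<c}. W t = ereal (app \<phi> t)"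
    "\<bar>W c\<bar> = \<infinity>" "\<phi> \<in> S_plus F x y" "has_lim_plus \<phi> (W c)"
proof -
  have Wcont: "continuous_on {x..} W" using W unfolding esol_def by blast
  define A where "A = {x..} \<inter> W -` {\<infinity>, -\<infinity>}"
  have A: "t \<in> A \<longleftrightarrow> x \<le> t \<and> \<bar>W t\<bar> = \<infinity>" for t unfolding A_def by (cases "W t") auto
  have "closed A" unfolding A_def by (intro continuous_closed_preimage Wcont) auto
  moreover have "A \<noteq> {}" using inf A[of t0] by auto
  moreover have bdd: "bdd_below A" by (rule bdd_belowI[of _ x]) (simp add: A)
  ultimately have cA: "Inf A \<in> A" by (intro closed_contains_Inf)
  define c where "c = Inf A"
  have c: "x \<le> c" "\<bar>W c\<bar> = \<infinity>" using cA A[of "Inf A"] unfolding c_def by auto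
  have xc: "x < c" using c y by (cases "x = c") auto
  have fin: "W t = ereal (real_of_ereal (W t))" if "t \<in> {x..<c}" for t
  proof -
    have "t \<notin> A" using that cInf_lower[OF _ bdd, of t] unfolding c_def by force
    then show ?thesis using that A[of t] by (simp add: ereal_real')
  qed
  let ?\<phi> = "(\<lambda>t. Some (real_of_ereal (W t))) |` {x..<c}"
  have rs: "right_solution F x y ?\<phi>"
  proof (rule right_solution_restrict[OF F])
    show "{x..<c} = {x..} \<or> (\<exists>b>x. {x..<c} = {x..<b})" using xc by blast
    fix t assume t: "t \<in> {x..<c}"
    then have "((\<lambda>t. real_of_ereal (W t)) has_real_derivative F (t, real_of_ereal (W t))) (at t within {x..})"
      using W fin[of t] unfolding esol_def by simp
    then show "((\<lambda>t. real_of_ereal (W t)) has_real_derivative F (t, real_of_ereal (W t))) (at t within {x..<c})"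
      by (rule DERIV_subset) auto
  qed (use y in auto)
  have dom: "dom ?\<phi> = {x..<c}" by (auto simp: restrict_map_def split: if_splits)
  have eq: "W t = ereal (app ?\<phi> t)" if "t \<in> {x..<c}" for t using fin that by simp
  have ev: "\<forall>\<^sub>F t in at_left c. t \<in> {x..<c}"
    using eventually_at_left_real[OF xc] by eventually_elim auto
  have "(W \<longlongrightarrow> W c) (at c within {x..})" using Wcont c unfolding continuous_on_def by auto
  then have "(W \<longlongrightarrow> W c) (at c within {x..<c})" by (rule tendsto_within_subset) auto
  moreover have atc: "at c within {x..<c} = at_left c"
    by (rule at_within_nhd[of c "{x<..}"]) (use xc in auto)
  ultimately have Wlim: "(W \<longlongrightarrow> W c) (at_left c)" by simp
  then have "((\<lambda>t. ereal (app ?\<phi> t)) \<longlongrightarrow> W c) (at_left c)"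
    by (rule Lim_transform_eventually) (use ev eq in \<open>auto elim: eventually_mono\<close>)
  then have lim: "has_lim_plus ?\<phi> (W c)" using has_lim_plus_iff[OF xc dom] by simp
  have "\<psi> = ?\<phi>" if \<psi>: "right_solution F x y \<psi>" and le: "?\<phi> \<subseteq>\<^sub>m \<psi>" for \<psi>
  proof (rule map_le_antisym[OF _ le])
    have le': "\<psi> t = ?\<phi> t" if "t \<in> {x..<c}" for t using le that dom unfolding map_le_def by metis
    have cd': "c \<notin> dom \<psi>"
    proof
      assume cd: "c \<in> dom \<psi>"
      have sub: "{x..<c} \<subseteq> dom \<psi>" using \<psi> cd by (cases rule: right_solution_domE) auto
      have "((\<lambda>t. ereal (app \<psi> t)) \<longlongrightarrow> ereal (app \<psi> c)) (at c within dom \<psi>)"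
        using right_solution_esol[OF \<psi>] cd unfolding esol_def continuous_on_def by blast
      then have "((\<lambda>t. ereal (app \<psi> t)) \<longlongrightarrow> ereal (app \<psi> c)) (at_left c)"
        unfolding atc[symmetric] using sub by (rule tendsto_within_subset)
      moreover have "\<forall>\<^sub>F t in at_left c. ereal (app \<psi> t) = W t"
        using ev by eventually_elim (use eq le' in auto)
      ultimately have "(W \<longlongrightarrow> ereal (app \<psi> c)) (at_left c)" by (rule Lim_transform_eventually)
      then have "W c = ereal (app \<psi> c)" using tendsto_unique[OF _ Wlim] by simp
      then show False using c by simp
    qed
    have "dom \<psi> \<subseteq> {x..<c}" using \<psi> cd' c(1) by (cases rule: right_solution_domE) auto
    then show "\<psi> \<subseteq>\<^sub>m ?\<phi>" using le' unfolding map_le_def by blast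
  qed
  then have "?\<phi> \<in> S_plus F x y" unfolding S_plus_def using rs by blast
  then show thesis using that[OF xc dom _ c(2) _ lim] eq by blast
qed

section \<open>The three cases\<close>

lemma abs_app_le_if_sup_norm_on_le:
  assumes \<phi>: "right_solution F x y \<phi>" and sub: "{p..q} \<subseteq> dom \<phi>" and h: "sup_norm_on {p..q} \<phi> \<le> h"
    and t: "t \<in> {p..q}"
  shows "\<bar>app \<phi> t\<bar> \<le> h"
proof -
  have "(app \<phi> has_real_derivative F (t, app \<phi> t)) (at t within dom \<phi>)" if "t \<in> dom \<phi>" for t
    using \<phi> that unfolding right_solution_def by blast
  then have "continuous_on (dom \<phi>) (app \<phi>)" by (rule DERIV_continuous_on)
  then have "continuous_on {p..q} (\<lambda>t. \<bar>app \<phi> t\<bar>)"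
    by (intro continuous_on_rabs continuous_on_subset[OF _ sub])
  then have "bdd_above ((\<lambda>t. \<bar>app \<phi> t\<bar>) ` {p..q})"
    by (intro bounded_imp_bdd_above compact_imp_bounded compact_continuous_image) auto
  then have "\<bar>app \<phi> t\<bar> \<le> sup_norm_on {p..q} \<phi>" unfolding sup_norm_on_def using t by (rule cSUP_upper[rotated])
  then show ?thesis using h by simp
qed

text \<open>The assumption \<open>no\<close> ignores the norm bound, so it implies (ii) for every
  \<open>h\<close>. This leaves \<open>h\<close> free to be any integer above the norm of the global
  solution.\<close>

lemma global_solution_H_excl:
  assumes F: "F \<in> C_plane" and \<phi>: "\<phi> \<in> S_plus F x y" "dom \<phi> = {x..}"
    and no: "\<not> (\<exists>\<psi>\<in>S_plus F x y. {x..x + real N} \<subseteq> dom \<psi> \<and> has_lim_plus \<psi> l)"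
  shows "(F, x, y) \<in> H_excl l"
proof -
  obtain h :: nat where "sup_norm_on {x..x + real N} \<phi> \<le> real h" using real_arch_simple by blast
  then have "\<forall>n::nat\<ge>1. \<exists>\<phi>\<in>S_plus F x y. {x..x + real N + real n} \<subseteq> dom \<phi> \<and> sup_norm_on {x..x + real N} \<phi> \<le> real h"
    using \<phi> by (intro allI impI bexI[of _ \<phi>]) auto
  then show ?thesis unfolding H_excl_def using F no by blast
qed

text \<open>By contraposition of the preceding lemma, a global solution outside
  \<open>H_minus\<close> and \<open>H_plus\<close> forces, for each N, solutions living on [x,x+N]
  with limits in both directions.\<close>

lemma G_plus_subset: "G_plus \<subseteq> H_minus \<union> H_plus \<union> H_infty"
proof (rule subsetI)
  fix p assume "p \<in> G_plus"
  then obtain F x y \<phi> where p: "p = (F, x, y)" and F: "F \<in> C_plane" and \<phi>: "\<phi> \<in> S_plus F x y" "dom \<phi> = {x..}"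
    unfolding G_plus_def by blast
  show "p \<in> H_minus \<union> H_plus \<union> H_infty"
  proof (rule ccontr)
    assume "p \<notin> H_minus \<union> H_plus \<union> H_infty"
    then have "(F, x, y) \<notin> H_excl (-\<infinity>)" "(F, x, y) \<notin> H_excl \<infinity>" "p \<notin> H_infty"
      unfolding H_minus_def H_plus_def p by auto
    then have "\<exists>\<psi>\<in>S_plus F x y. {x..x + real N} \<subseteq> dom \<psi> \<and> has_lim_plus \<psi> (-\<infinity>)"
      "\<exists>\<psi>\<in>S_plus F x y. {x..x + real N} \<subseteq> dom \<psi> \<and> has_lim_plus \<psi> \<infinity>" for N
      using global_solution_H_excl[OF F \<phi>] by blast+
    then have "p \<in> H_infty" unfolding H_infty_def p using F by simp blast
    then show False using \<open>p \<notin> H_infty\<close> by blast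
  qed
qed

lemma H_excl_subset_G_plus:
  assumes l: "\<bar>l\<bar> = \<infinity>"
  shows "H_excl l \<subseteq> G_plus"
proof (rule subsetI, rule ccontr)
  fix p assume "p \<in> H_excl l" and nG: "p \<notin> G_plus"
  then obtain F x y N h where p: "p = (F, x, y)" and FC: "F \<in> C_plane"
    and ex: "\<And>n::nat. n \<ge> 1 \<Longrightarrow> \<exists>\<phi>\<in>S_plus F x y. {x..x + real N + real n} \<subseteq> dom \<phi> \<and>
            sup_norm_on {x..x + real N} \<phi> \<le> real h"
    and no: "\<And>\<phi>. \<phi> \<in> S_plus F x y \<Longrightarrow> {x..x + real N} \<subseteq> dom \<phi> \<Longrightarrow>
            sup_norm_on {x..x + real N} \<phi> \<le> real h \<Longrightarrow> \<not> has_lim_plus \<phi> l"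
    unfolding H_excl_def by blast
  have F: "continuous_on UNIV F" using FC unfolding C_plane_def by simp
  have "\<exists>U. esol F {x..} U \<and> U x = ereal y \<and> (\<forall>t\<ge>x. U t \<noteq> l) \<and> (\<forall>t\<in>{x..x + real N + real (Suc n)}. \<bar>U t\<bar> \<noteq> \<infinity>)
      \<and> (\<forall>t\<in>{x..x + real N}. - ereal (real h) \<le> U t \<and> U t \<le> ereal (real h))" for n
  proof -
    obtain \<phi> where \<phi>: "\<phi> \<in> S_plus F x y" and sub: "{x..x + real N + real (Suc n)} \<subseteq> dom \<phi>"
      and nrm: "sup_norm_on {x..x + real N} \<phi> \<le> real h"
      using ex[of "Suc n"] by auto
    have rs: "right_solution F x y \<phi>" using \<phi> unfolding S_plus_def by blast
    have sub': "{x..x + real N} \<subseteq> dom \<phi>" by (rule order_trans[OF _ sub]) auto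
    from F \<phi> show ?thesis
    proof (cases rule: maximal_solution_global_or_blowup)
      case 1
      then show ?thesis using nG \<phi> FC unfolding G_plus_def p by blast
    next
      case (2 b m)
      have m: "m \<noteq> l" using no[OF \<phi> sub' nrm] 2 by blast
      have lt: "t < b" if "t \<in> {x..x + real N + real (Suc n)}" for t using sub that 2 by auto
      show ?thesis
      proof (intro exI[of _ "\<lambda>t. if t < b then ereal (app \<phi> t) else m"] conjI ballI allI impI 2)
        show "(if x < b then ereal (app \<phi> x) else m) = ereal y"
          using 2 rs unfolding right_solution_def by simp
        show "(if t < b then ereal (app \<phi> t) else m) \<noteq> l" for t using m l by auto
        show "\<bar>if t < b then ereal (app \<phi> t) else m\<bar> \<noteq> \<infinity>" if "t \<in> {x..x + real N + real (Suc n)}" for t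
          using lt[OF that] by simp
        fix t assume t: "t \<in> {x..x + real N}"
        then have "t < b" by (intro lt) auto
        moreover have "\<bar>app \<phi> t\<bar> \<le> real h" by (rule abs_app_le_if_sup_norm_on_le[OF rs sub' nrm t])
        ultimately show "- ereal (real h) \<le> (if t < b then ereal (app \<phi> t) else m)"
          "(if t < b then ereal (app \<phi> t) else m) \<le> ereal (real h)" by auto
      qed
    qed
  qed
  then obtain U where U: "\<And>n. esol F {x..} (U n)" and Ux: "\<And>n. U n x = ereal y"
    and Ul: "\<And>n t. x \<le> t \<Longrightarrow> U n t \<noteq> l"
    and Ufin: "\<And>n t. t \<in> {x..x + real N + real (Suc n)} \<Longrightarrow> \<bar>U n t\<bar> \<noteq> \<infinity>"
    and Uh: "\<And>n t. t \<in> {x..x + real N} \<Longrightarrow> - ereal (real h) \<le> U n t \<and> U n t \<le> ereal (real h)"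
    by metis
  have Ufin': "\<exists>n. \<bar>U n t\<bar> \<noteq> \<infinity>" if "x \<le> t" for t
  proof -
    obtain n where "t - x \<le> real n" using real_arch_simple by blast
    then have "t \<in> {x..x + real N + real (Suc n)}" using that by auto
    then show ?thesis by (intro exI Ufin)
  qed
  \<comment> \<open>For each t some \<open>U n t\<close> is finite, so a supremum cannot be
    -\<infinity> and an infimum cannot be \<infinity>. This rules out -l; the value \<open>l\<close>
    itself may arise from infinitely many terms.\<close>
  obtain W where W: "esol F {x..} W" and Wx: "W x = ereal y" and Wl: "\<And>t. x \<le> t \<Longrightarrow> W t \<noteq> - l"
    and Wh: "\<And>t. t \<in> {x..x + real N} \<Longrightarrow> - ereal (real h) \<le> W t \<and> W t \<le> ereal (real h)"
  proof (cases "l = \<infinity>")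
    case True
    show thesis
    proof (rule that[OF esol_SUP[OF F U]])
      show "(SUP n. U n x) = ereal y" using Ux by simp
      show "(SUP n. U n t) \<noteq> - l" if xt: "x \<le> t" for t
      proof -
        obtain n where "\<bar>U n t\<bar> \<noteq> \<infinity>" using Ufin'[OF xt] by (rule exE)
        moreover have "U n t \<le> (SUP n. U n t)" by (rule SUP_upper) simp
        ultimately show ?thesis using True by auto
      qed
      show "- ereal (real h) \<le> (SUP n. U n t) \<and> (SUP n. U n t) \<le> ereal (real h)" if "t \<in> {x..x + real N}" for t
        using Uh[OF that] by (meson SUP_least SUP_upper2 UNIV_I)
    qed
  next
    case False
    then have l': "l = -\<infinity>" using l by (cases l) auto
    show thesis
    proof (rule that[OF esol_INF[OF F U]])
      show "(INF n. U n x) = ereal y" using Ux by simp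
      show "(INF n. U n t) \<noteq> - l" if xt: "x \<le> t" for t
      proof -
        obtain n where "\<bar>U n t\<bar> \<noteq> \<infinity>" using Ufin'[OF xt] by (rule exE)
        moreover have "(INF n. U n t) \<le> U n t" by (rule INF_lower) simp
        ultimately show ?thesis using l' by auto
      qed
      show "- ereal (real h) \<le> (INF n. U n t) \<and> (INF n. U n t) \<le> ereal (real h)" if "t \<in> {x..x + real N}" for t
        using Uh[OF that] by (meson INF_greatest INF_lower2 UNIV_I)
    qed
  qed
  obtain t0 where t0: "x \<le> t0" "\<bar>W t0\<bar> = \<infinity>" 
    using esol_finite_G_plus[OF F W Wx] nG unfolding p by metis
  obtain c \<phi> where c: "x < c" "dom \<phi> = {x..<c}" "\<forall>t\<in>{x..<c}. W t = ereal (app \<phi> t)"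
    "\<bar>W c\<bar> = \<infinity>" "\<phi> \<in> S_plus F x y" "has_lim_plus \<phi> (W c)"
    using esol_first_infinity[OF F W Wx t0] .
  have "W c = l" using c(4) l Wl[of c] c(1) by (cases l; cases "W c") auto
  \<comment> \<open>The bound by \<open>h\<close> keeps \<open>W\<close> finite up to x+N, so the
    solution cut at \<open>c\<close> satisfies every requirement of (ii).\<close>
  have "c \<notin> {x..x + real N}" using Wh[of c] c(4) by (cases "W c") auto
  then have sub: "{x..x + real N} \<subseteq> {x..<c}" using c(1) by auto
  have "sup_norm_on {x..x + real N} \<phi> \<le> real h"
    unfolding sup_norm_on_def
  proof (rule cSUP_least)
    fix t assume t: "t \<in> {x..x + real N}"
    then have "W t = ereal (app \<phi> t)" using c(3) sub by blast
    then show "\<bar>app \<phi> t\<bar> \<le> real h" using Wh[OF t] by auto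
  qed simp
  then show False using no[OF c(5)] sub c(2,6) \<open>W c = l\<close> by blast
qed

text \<open>Acts on the values at one fixed time. Only \<open>min\<close> and \<open>max\<close>
  occur, so applied at all times it turns solutions into solutions. The lower entry is capped by the
  new upper entry a', not the old one, which preserves the order of the pair.\<close>

primrec squeeze :: "(nat \<Rightarrow> ereal) \<Rightarrow> (nat \<Rightarrow> ereal) \<Rightarrow> nat \<Rightarrow> ereal \<times> ereal" where
  "squeeze u v 0 = (max (u 0) (v 0), min (u 0) (v 0))"
| "squeeze u v (Suc n) =
    (let (a, b) = squeeze u v n; a' = max b (min a (u (Suc n)))
     in (a', min a' (max b (v (Suc n)))))"

lemma squeeze_Suc:
  "fst (squeeze u v (Suc n)) = max (snd (squeeze u v n)) (min (fst (squeeze u v n)) (u (Suc n)))"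
  "snd (squeeze u v (Suc n)) = min (fst (squeeze u v (Suc n))) (max (snd (squeeze u v n)) (v (Suc n)))"
  by (simp_all add: Let_def split_beta)

lemma squeeze_ordered: "snd (squeeze u v n) \<le> fst (squeeze u v n)"
proof (cases n)
  case (Suc m)
  then show ?thesis by (simp only: squeeze_Suc) simp
qed (simp add: min_le_iff_disj)

lemma decseq_fst_squeeze: "decseq (\<lambda>n. fst (squeeze u v n))"
  by (rule decseq_SucI) (simp add: squeeze_Suc squeeze_ordered del: squeeze.simps)

lemma incseq_snd_squeeze: "incseq (\<lambda>n. snd (squeeze u v n))"
  by (rule incseq_SucI) (simp add: squeeze_Suc squeeze_ordered del: squeeze.simps)

text \<open>Finiteness at stage \<open>n\<close> depends on \<open>u n\<close> and
  \<open>v n\<close> alone: the upper entry is at most the larger of \<open>u n\<close> and a lower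
  entry, which is never \<infinity>, and symmetrically below. Earlier members that blow up sooner do
  not shorten the life span of the stage.\<close>

lemma squeeze_not_infinite:
  assumes "\<And>i. u i \<noteq> -\<infinity>" "\<And>i. v i \<noteq> \<infinity>"
  shows "fst (squeeze u v n) \<noteq> -\<infinity>" "snd (squeeze u v n) \<noteq> \<infinity>"
    "u n \<noteq> \<infinity> \<Longrightarrow> fst (squeeze u v n) \<noteq> \<infinity>" "v n \<noteq> -\<infinity> \<Longrightarrow> snd (squeeze u v n) \<noteq> -\<infinity>"
proof -
  have 12: "fst (squeeze u v n) \<noteq> -\<infinity> \<and> snd (squeeze u v n) \<noteq> \<infinity>" for n
  proof (induction n)
    case 0
    then show ?case using assms(1,2)[of 0] by (auto simp: max_def min_def)
  next
    case (Suc n)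
    then show ?case using assms(1,2)[of "Suc n"] unfolding squeeze_Suc by (auto simp: max_def min_def)
  qed
  then show "fst (squeeze u v n) \<noteq> -\<infinity>" "snd (squeeze u v n) \<noteq> \<infinity>" by auto
  show "fst (squeeze u v n) \<noteq> \<infinity>" if "u n \<noteq> \<infinity>"
  proof (cases n)
    case 0
    then show ?thesis using that assms(2)[of 0] by (auto simp: max_def)
  next
    case (Suc m)
    then show ?thesis using that 12[of m] by (auto simp: squeeze_Suc max_def min_def simp del: squeeze.simps)
  qed
  show "snd (squeeze u v n) \<noteq> -\<infinity>" if "v n \<noteq> -\<infinity>"
  proof (cases n)
    case 0
    then show ?thesis using that assms(1)[of 0] by (auto simp: min_def)
  next
    case (Suc m)
    then show ?thesis using that 12[of "Suc m"]
      unfolding Suc squeeze_Suc(2) by (auto simp: max_def min_def simp del: squeeze.simps)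
  qed
qed

lemma esol_squeeze:
  assumes U: "\<And>n. esol F I (U n)" and V: "\<And>n. esol F I (V n)"
  shows "esol F I (\<lambda>t. fst (squeeze (\<lambda>i. U i t) (\<lambda>i. V i t) n)) \<and>
         esol F I (\<lambda>t. snd (squeeze (\<lambda>i. U i t) (\<lambda>i. V i t) n))"
proof (induction n)
  case 0
  then show ?case by (simp add: esol_max esol_min U V)
next
  case (Suc n)
  then have "esol F I (\<lambda>t. fst (squeeze (\<lambda>i. U i t) (\<lambda>i. V i t) (Suc n)))"
    unfolding squeeze_Suc by (intro esol_max esol_min U V) auto
  then show ?case unfolding squeeze_Suc(2) using Suc by (intro conjI esol_max esol_min U V) auto
qed

lemma H_infty_subset_G_plus: "H_infty \<subseteq> G_plus"
proof (rule subsetI, rule ccontr)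
  fix p assume "p \<in> H_infty" and nG: "p \<notin> G_plus"
  then obtain F x y where p: "p = (F, x, y)" and FC: "F \<in> C_plane"
    and ex: "\<And>n::nat. n \<ge> 1 \<Longrightarrow> \<exists>\<phi>\<in>S_plus F x y. \<exists>\<psi>\<in>S_plus F x y.
        {x..x + real n} \<subseteq> dom \<phi> \<inter> dom \<psi> \<and> has_lim_plus \<phi> \<infinity> \<and> has_lim_plus \<psi> (-\<infinity>)"
    unfolding H_infty_def by blast
  have F: "continuous_on UNIV F" using FC unfolding C_plane_def by simp
  have ext: "\<exists>U. esol F {x..} U \<and> U x = ereal y \<and> (\<forall>t\<ge>x. U t \<noteq> - l) \<and> (\<forall>t\<in>{x..x + real (Suc n)}. \<bar>U t\<bar> \<noteq> \<infinity>)"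
    if \<phi>: "\<phi> \<in> S_plus F x y" and sub: "{x..x + real (Suc n)} \<subseteq> dom \<phi>" and lim: "has_lim_plus \<phi> l" for n \<phi> l
    using F \<phi>
  proof (cases rule: maximal_solution_global_or_blowup)
    case 1
    then show ?thesis using nG \<phi> FC unfolding G_plus_def p by blast
  next
    case (2 b m)
    \<comment> \<open>The infinite constant used for the continuation is the prescribed limit, by
      uniqueness of limits.\<close>
    have "m = l" using lim 2(4) unfolding has_lim_plus_iff[OF 2(1,2)] by (intro tendsto_unique) auto
    then have ml: "m \<noteq> - l" "\<bar>l\<bar> = \<infinity>" using 2(3) by (cases l; auto)+
    have lt: "t < b" if "t \<in> {x..x + real (Suc n)}" for t using sub that 2 by auto
    show ?thesis
    proof (intro exI[of _ "\<lambda>t. if t < b then ereal (app \<phi> t) else m"] conjI ballI allI impI 2)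
      show "(if x < b then ereal (app \<phi> x) else m) = ereal y"
        using 2 \<phi> unfolding S_plus_def right_solution_def by simp
      show "(if t < b then ereal (app \<phi> t) else m) \<noteq> - l" for t using ml by (cases l) auto
      show "\<bar>if t < b then ereal (app \<phi> t) else m\<bar> \<noteq> \<infinity>" if "t \<in> {x..x + real (Suc n)}" for t
        using lt[OF that] by simp
    qed
  qed
  have "\<exists>U. esol F {x..} U \<and> U x = ereal y \<and> (\<forall>t\<ge>x. U t \<noteq> -\<infinity>) \<and> (\<forall>t\<in>{x..x + real (Suc n)}. \<bar>U t\<bar> \<noteq> \<infinity>)" for n
    using ex[of "Suc n"] ext[where l = \<infinity> and n = n] by auto
  then obtain U where U: "\<And>n. esol F {x..} (U n)" "\<And>n. U n x = ereal y" "\<And>n t. x \<le> t \<Longrightarrow> U n t \<noteq> -\<infinity>"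
    "\<And>n t. t \<in> {x..x + real (Suc n)} \<Longrightarrow> \<bar>U n t\<bar> \<noteq> \<infinity>" by metis
  have "\<exists>U. esol F {x..} U \<and> U x = ereal y \<and> (\<forall>t\<ge>x. U t \<noteq> \<infinity>) \<and> (\<forall>t\<in>{x..x + real (Suc n)}. \<bar>U t\<bar> \<noteq> \<infinity>)" for n
    using ex[of "Suc n"] ext[where l = "-\<infinity>" and n = n] by auto
  then obtain V where V: "\<And>n. esol F {x..} (V n)" "\<And>n. V n x = ereal y" "\<And>n t. x \<le> t \<Longrightarrow> V n t \<noteq> \<infinity>"
    "\<And>n t. t \<in> {x..x + real (Suc n)} \<Longrightarrow> \<bar>V n t\<bar> \<noteq> \<infinity>" by metis
  define S where "S t = squeeze (\<lambda>i. U i t) (\<lambda>i. V i t)" for t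
  define W where "W t = (INF n. fst (S t n))" for t
  \<comment> \<open>Lower and upper entries of different stages are compared at the later stage.
    Each lower entry is thus a barrier that keeps the infimum of the upper ones from
    -\<infinity>.\<close>
  have bounds: "snd (S t k) \<le> W t" "W t \<le> fst (S t k)" for t k
  proof -
    show "W t \<le> fst (S t k)" unfolding W_def by (rule INF_lower) simp
    show "snd (S t k) \<le> W t"
      unfolding W_def
    proof (rule INF_greatest)
      fix n
      have "snd (S t k) \<le> snd (S t (max n k))" unfolding S_def by (rule incseqD[OF incseq_snd_squeeze]) simp
      also have "\<dots> \<le> fst (S t (max n k))" unfolding S_def by (rule squeeze_ordered)
      also have "\<dots> \<le> fst (S t n)" unfolding S_def by (rule decseqD[OF decseq_fst_squeeze]) simp
      finally show "snd (S t k) \<le> fst (S t n)" .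
    qed
  qed
  have "esol F {x..} W"
    unfolding W_def S_def using esol_squeeze[of F "{x..}" U V] U(1) V(1) by (intro esol_INF[OF F]) blast
  moreover have "W x = ereal y"
    using bounds[of x 0] U(2)[of 0] V(2)[of 0] by (simp add: S_def)
  moreover have "\<bar>W t\<bar> \<noteq> \<infinity>" if t: "x \<le> t" for t
  proof -
    \<comment> \<open>At stage \<open>k\<close> both entries are finite up to time x+k+1, so they
      enclose \<open>W t\<close> between real numbers.\<close>
    obtain k where "t - x \<le> real k" using real_arch_simple by blast
    then have tk: "t \<in> {x..x + real (Suc k)}" using t by auto
    have "fst (S t k) \<noteq> \<infinity>" "snd (S t k) \<noteq> -\<infinity>"
      unfolding S_def using U(3)[OF t] V(3)[OF t] U(4)[OF tk] V(4)[OF tk]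
      by (intro squeeze_not_infinite; force)+
    then show ?thesis using bounds[of t k] by (cases "W t") auto
  qed
  ultimately have "(F, x, y) \<in> G_plus" by (rule esol_finite_G_plus[OF F])
  then show False using nG p by simp
qed

theorem theorem5p18: "G_plus = H_minus \<union> H_plus \<union> H_infty"
  using G_plus_subset H_infty_subset_G_plus H_excl_subset_G_plus[of "-\<infinity>"] H_excl_subset_G_plus[of \<infinity>]
  unfolding H_minus_def H_plus_def by auto

end
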